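(* Let $p$ be a prime, $q$ a power of $p$, and $R=\mathbb{F}_q[[u]]$. The group $S_{(p)}$ acts as automorphisms of the convolution algebra of $R$-valued measures on $R$. (Here, for a fixed digit-expansion basis $\{G_t\}_{t\ge 0}$ of the continuous functions $R\to R$, an element $\sigma\in S_{(p)}$ sends a measure $\mu$ to the measure $\sigma\mu$ determined by $(\sigma\mu)(G_{\sigma(t)})=\mu(G_t)$ for all integers $t\ge 0$.)
   Context: $S_{(p)}$: for a permutation $\rho$ of $\{0,1,2,\dots\}$ and $x=\sum_{i\ge0}c_ip^i\in\mathbb{Z}_p$ with $0\le c_i<p$, put $\rho_\ast(x)=\sum_{i\ge0}c_ip^{\rho(i)}$; $S_{(p)}$ is the group of all bijections $\rho_\ast$ of $\mathbb{Z}_p$. These permute the nonnegative integers. $R$-valued measures on $R$ are continuous $R$-linear functionals $\mu$ on the Banach algebra $C(R,R)$ of continuous functions $R\to R$ (sup norm); convolution is $(\mu*\nu)(f)=\int\int f(x+y)\,d\mu(x)\,d\nu(y)$. Digit-expansion basis: let $\{e_i\}_{i\ge0}$ be an orthonormal basis of the Banach space of continuous $\mathbb{F}_q$-linear functions $R\to R$ (so each such function is uniquely $\sum a_ie_i$ with $a_i\in R$, $a_i\to0$, and sup norm $\max|a_i|$). For an integer $t=\sum_i t_iq^i$ with $0\le t_i<q$ set $G_t=\prod_i e_i^{t_i}$. It is known that $\{G_t\}_{t\ge0}$ is an orthonormal basis of $C(R,R)$; hence $\mu\mapsto\sum_{t\ge0}\mu(G_t)\frac{z^t}{t!}$ is a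 bijection from measures to formal divided power series over $R$, where the latter are multiplied by $\frac{z^i}{i!}\cdot\frac{z^j}{j!}=\binom{i+j}{i}\frac{z^{i+j}}{(i+j)!}$, and it is known that this is an isomorphism of $R$-algebras. *)

theory Defs
  imports
    "HOL-Analysis.Bounded_Continuous_Function"
    "HOL-Computational_Algebra.Formal_Power_Series"
    "HOL-Algebra.Algebraic_Closure_Type"
    "HOL-Algebra.Group_Action"
begin

section \<open>The $p$-adic integers and the group $S_{(p)}$\<close>

text \<open>
  The $p$-adic integers as the inverse limit of the rings of integers modulo $p^n$: an element is
  the coherent sequence of its residues.
\<close>

definition zp :: "nat \<Rightarrow> (nat \<Rightarrow> nat) set" where
  "zp p = {x. \<forall>n. x n < p ^ n \<and> x (Suc n) mod p ^ n = x n}"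

definition zp_of_nat :: "nat \<Rightarrow> nat \<Rightarrow> (nat \<Rightarrow> nat)" where
  "zp_of_nat p t = (\<lambda>n. t mod p ^ n)"

definition zp_digit :: "nat \<Rightarrow> (nat \<Rightarrow> nat) \<Rightarrow> nat \<Rightarrow> nat" where
  "zp_digit p x i = x (Suc i) div p ^ i"

text \<open>
  The $n$-th residue of $\sum_i c_i p^{\rho(i)}$ is that of the finite subsum of the terms
  with $\rho(i) < n$, as all other terms are divisible by $p^n$.
\<close>

definition rho_star :: "nat \<Rightarrow> (nat \<Rightarrow> nat) \<Rightarrow> (nat \<Rightarrow> nat) \<Rightarrow> (nat \<Rightarrow> nat)" where
  "rho_star p \<rho> x = (\<lambda>n. (\<Sum>i | \<rho> i < n. zp_digit p x i * p ^ \<rho> i) mod p ^ n)"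

definition S_group :: "nat \<Rightarrow> ((nat \<Rightarrow> nat) \<Rightarrow> (nat \<Rightarrow> nat)) monoid" where
  "S_group p = (BijGroup (zp p))\<lparr>carrier := {restrict (rho_star p \<rho>) (zp p) | \<rho>. bij \<rho>}\<rparr>"

text \<open>The permutation of the nonnegative integers induced by an element of $S_{(p)}$.\<close>

definition on_nat :: "nat \<Rightarrow> ((nat \<Rightarrow> nat) \<Rightarrow> (nat \<Rightarrow> nat)) \<Rightarrow> nat \<Rightarrow> nat" where
  "on_nat p \<sigma> t = (THE s. zp_of_nat p s = \<sigma> (zp_of_nat p t))"


section \<open>Continuous functions and orthonormal bases\<close>

text \<open>
  For the metric of the library two power series have distance $2^{-k}$, where $k$ is the order of
  their difference; hence all distances are at most $1$, every continuous function is bounded, and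
  \<^typ>\<open>'a fps \<Rightarrow>\<^sub>C 'a fps\<close> consists of all continuous functions, with the supremum
  metric. The absolute value of \<open>a\<close> is \<open>dist a 0\<close>, the supremum norm of \<open>f\<close> is
  \<open>dist f (const_bcontfun 0)\<close>.
\<close>

lemma apply_Bcontfun_fps:
  fixes f :: "'a::field fps \<Rightarrow> 'a fps"
  assumes "continuous_on UNIV f"
  shows "apply_bcontfun (Bcontfun f) = f"
proof -
  have "dist x y \<le> 1" for x y :: "'a fps"
    by (simp add: dist_fps_def inverse_le_1_iff)
  then have "bounded (range f)"
    unfolding bounded_def by blast
  with assms show ?thesis
    by (simp add: Bcontfun_inverse bcontfun_def)
qed

definition expansion ::
    "(nat \<Rightarrow> ('a::field fps \<Rightarrow>\<^sub>C 'a fps)) \<Rightarrow> (nat \<Rightarrow> 'a fps) \<Rightarrow> ('a fps \<Rightarrow>\<^sub>C 'a fps) \<Rightarrow> bool" where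
  "expansion e a f \<longleftrightarrow>
     a \<longlonglongrightarrow> 0 \<and> (\<lambda>n. Bcontfun (\<lambda>x. \<Sum>i<n. a i * e i x)) \<longlonglongrightarrow> f"

text \<open>The supremum below is a maximum, since the coefficients tend to zero.\<close>

definition orthonormal_basis ::
    "('a::field fps \<Rightarrow>\<^sub>C 'a fps) set \<Rightarrow> (nat \<Rightarrow> ('a fps \<Rightarrow>\<^sub>C 'a fps)) \<Rightarrow> bool" where
  "orthonormal_basis V e \<longleftrightarrow>
     range e \<subseteq> V \<and>
     (\<forall>f\<in>V. \<exists>!a. expansion e a f) \<and>
     (\<forall>f\<in>V. \<forall>a. expansion e a f \<longrightarrow> dist f (const_bcontfun 0) = (SUP i. dist (a i) 0))"

definition linear_functions :: "('a::field fps \<Rightarrow>\<^sub>C 'a fps) set" where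
  "linear_functions =
     {f :: 'a fps \<Rightarrow>\<^sub>C 'a fps.
        (\<forall>x y. f (x + y) = f x + f y) \<and>
        (\<forall>c x. f (fps_const c * x) = fps_const c * f x)}"

definition digit_expansion ::
    "(nat \<Rightarrow> ('a::{field,finite} fps \<Rightarrow>\<^sub>C 'a fps)) \<Rightarrow> nat \<Rightarrow> ('a fps \<Rightarrow>\<^sub>C 'a fps)" where
  "digit_expansion e t =
     (let q = CARD('a); d = (\<lambda>i. t div q ^ i mod q)
      in Bcontfun (\<lambda>x. \<Prod>i | d i \<noteq> 0. e i x ^ d i))"


section \<open>The convolution algebra of measures\<close>

type_synonym 'a functional = "('a fps \<Rightarrow>\<^sub>C 'a fps) \<Rightarrow> 'a fps"

definition R_measures :: "'a::field functional set" where
  "R_measures =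
     {\<mu>. continuous_on UNIV \<mu> \<and>
         (\<forall>a b f g.
            \<mu> (Bcontfun (\<lambda>x. a * apply_bcontfun f x + b * apply_bcontfun g x)) = a * \<mu> f + b * \<mu> g)}"

definition convolution :: "'a::field functional \<Rightarrow> 'a functional \<Rightarrow> 'a functional" where
  "convolution \<mu> \<nu> =
     (\<lambda>f. \<mu> (Bcontfun (\<lambda>x. \<nu> (Bcontfun (\<lambda>y. apply_bcontfun f (x + y))))))"

text \<open>The unit is the Dirac measure at zero.\<close>

definition measure_algebra :: "('a::field fps, 'a functional) module" where
  "measure_algebra =
     \<lparr>carrier = R_measures,
      mult = convolution,
      one = (\<lambda>f. apply_bcontfun f 0),
      zero = (\<lambda>f. 0),
      add = (\<lambda>\<mu> \<nu> f. \<mu> f + \<nu> f),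
      module.smult = (\<lambda>a \<mu> f. a * \<mu> f)\<rparr>"

definition algebra_automorphisms :: "('r, 's) ring_scheme \<Rightarrow> ('r, 'm) module \<Rightarrow> ('m \<Rightarrow> 'm) set" where
  "algebra_automorphisms R M =
     {h \<in> ring_iso M M.
        \<forall>a\<in>carrier R. \<forall>x\<in>carrier M. h (a \<odot>\<^bsub>M\<^esub> x) = a \<odot>\<^bsub>M\<^esub> h x}"

text \<open>
  \<open>is_transform e p \<sigma> \<mu> \<nu>\<close> says that \<open>\<nu>\<close> is a measure with the property that determines
  $\sigma\mu$.
\<close>

definition is_transform ::
    "(nat \<Rightarrow> ('a::{field,finite} fps \<Rightarrow>\<^sub>C 'a fps)) \<Rightarrow> nat \<Rightarrow> ((nat \<Rightarrow> nat) \<Rightarrow> (nat \<Rightarrow> nat)) \<Rightarrow>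
      'a functional \<Rightarrow> 'a functional \<Rightarrow> bool" where
  "is_transform e p \<sigma> \<mu> \<nu> \<longleftrightarrow>
     \<nu> \<in> R_measures \<and>
     (\<forall>t. \<nu> (digit_expansion e (on_nat p \<sigma> t)) = \<mu> (digit_expansion e t))"

definition transform ::
    "(nat \<Rightarrow> ('a::{field,finite} fps \<Rightarrow>\<^sub>C 'a fps)) \<Rightarrow> nat \<Rightarrow> ((nat \<Rightarrow> nat) \<Rightarrow> (nat \<Rightarrow> nat)) \<Rightarrow>
      'a functional \<Rightarrow> 'a functional" where
  "transform e p \<sigma> = (\<lambda>\<mu>\<in>R_measures. THE \<nu>. is_transform e p \<sigma> \<mu> \<nu>)"

end

theory Submission
  imports Defs "HOL-Number_Theory.Residues"
begin

text \<open>
  Why the theorem is true. A measure $\mu$ is the same as its sequence of values $\mu(G_t)$ on the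
  digit expansion, and this sequence is arbitrary. In terms of these values the convolution is
  \[ (\mu * \nu)(G_t) = \sum_s {t \choose s}\, \mu(G_s)\, \nu(G_{t-s}). \]
  In characteristic $p$, Lucas's theorem makes ${t \choose s}$ the product of the binomial coefficients
  of the digits of $t$ and $s$ for the base $p$; in particular only those $s$ contribute whose digits
  are bounded by those of $t$, and for them $t - s$ is computed digit by digit. Every ingredient of
  the formula is thus compatible with a permutation of the digits, which is how $S_{(p)}$ acts on the
  indices.

  The convolution formula comes from an addition formula for $G_t(x + y)$, without a detour through
  binomial coefficients of large numbers. Writing digits for the base $q = p^m$ in terms of digits
  for the base $p$ exhibits $G_t$ as a product of powers, with the digits of $t$ for the base $p$ as
  exponents, of the functions $e_i^{p^j}$ for $j < m$. These are additive by Frobenius, and the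
  binomial theorem in each digit (\<open>digit_prod_add\<close>) gives the formula (\<open>digit_E_add\<close>,
  \<open>convolution_digit_E\<close>); the invariance under permutations is \<open>permute_measure_convolution\<close>.

  That measures correspond to arbitrary sequences (\<open>ex1_measure_with_values\<close>) rests on the digit
  principle: the residues of the $G_t$ modulo the maximal ideal form a basis of the locally constant
  functions with values in the residue field $k$. Indeed the residues of the $e_i$ are linearly
  independent functionals whose span contains the coefficient functions. The first $n$ of them
  therefore map the power series onto $k^n$, and for large $n$ a given locally constant function
  factors through this map. On $k^n$ the
  $q^n$ monomials with exponents below $q$ are independent, because a polynomial of degree less than
  $q$ in one variable has fewer than $q$ roots, and they span all functions by counting. Expansions
  modulo $X$ then lift to expansions modulo every $X^n$. A linear functional is automatically a
  contraction, which is why expansions modulo $X^n$ determine it modulo $X^n$.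
\<close>

unbundle fps_syntax
unbundle no vec_syntax

section \<open>Congruences of power series and continuity\<close>

text \<open>
  Distances of power series and of functions enter only through the question modulo which powers of
  the variable two series agree, which turns estimates into algebra.
\<close>

definition cong_X :: "nat \<Rightarrow> 'a::field fps \<Rightarrow> 'a fps \<Rightarrow> bool" where
  "cong_X n a b \<longleftrightarrow> fps_X ^ n dvd a - b"

lemma cong_X_iff_nth: "cong_X n a b \<longleftrightarrow> (\<forall>k<n. a $ k = b $ k)"
proof
  assume "cong_X n a b"
  then obtain c where c: "a - b = fps_X ^ n * c"
    unfolding cong_X_def by (elim dvdE)
  have "(a - b) $ k = 0" if "k < n" for k
    unfolding c using that by (simp add: fps_X_power_mult_nth)
  then show "\<forall>k<n. a $ k = b $ k" by simp
next
  assume *: "\<forall>k<n. a $ k = b $ k"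
  show "cong_X n a b"
  proof (cases "a = b")
    case False
    then have "subdegree (a - b) \<ge> n"
      by (intro subdegree_geI) (use * in auto)
    with False show ?thesis
      by (simp add: cong_X_def fps_dvd_iff fps_X_power_subdegree)
  qed (simp add: cong_X_def)
qed

lemma cong_X_0 [simp]: "cong_X 0 a b"
  and cong_X_refl [simp]: "cong_X n a a"
  and cong_X_sym: "cong_X n a b \<Longrightarrow> cong_X n b a"
  and cong_X_trans [trans]: "cong_X n a b \<Longrightarrow> cong_X n b c \<Longrightarrow> cong_X n a c"
  and cong_X_mono: "cong_X n a b \<Longrightarrow> m \<le> n \<Longrightarrow> cong_X m a b"
  and cong_X_1_iff: "cong_X 1 a b \<longleftrightarrow> a $ 0 = b $ 0"
  by (auto simp: cong_X_iff_nth)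

lemma cong_X_add: "cong_X n a b \<Longrightarrow> cong_X n c d \<Longrightarrow> cong_X n (a + c) (b + d)"
  by (simp add: cong_X_iff_nth)

lemma cong_X_mult:
  assumes "cong_X n a b" "cong_X n c d"
  shows "cong_X n (a * c) (b * d)"
proof -
  have "fps_X ^ n dvd (a - b) * c + b * (c - d)"
    using assms unfolding cong_X_def by (intro dvd_add dvd_mult2 dvd_mult)
  then show ?thesis by (simp add: cong_X_def algebra_simps)
qed

lemma cong_X_sum: "(\<And>i. i \<in> A \<Longrightarrow> cong_X n (a i) (b i)) \<Longrightarrow> cong_X n (sum a A) (sum b A)"
  by (induction A rule: infinite_finite_induct) (auto intro: cong_X_add)

lemma eq_if_cong_X: "(\<And>n. cong_X n a b) \<Longrightarrow> a = b"
  by (auto simp: cong_X_iff_nth fps_eq_iff)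

lemma cong_XE:
  assumes "cong_X n a b"
  obtains c where "a = b + fps_X ^ n * c"
proof -
  from assms obtain c where "a - b = fps_X ^ n * c"
    unfolding cong_X_def by (elim dvdE)
  then have "a = b + fps_X ^ n * c"
    by (simp add: algebra_simps)
  then show ?thesis by (rule that)
qed

lemma cong_X_mult_X_power_iff [simp]:
  "cong_X (n + m) (fps_X ^ n * a) (fps_X ^ n * b) \<longleftrightarrow> cong_X m a b"
  unfolding cong_X_def by (simp add: power_add flip: right_diff_distrib)

lemma dist_less_iff_cong_X: "dist a b < inverse (2 ^ n) \<longleftrightarrow> cong_X (Suc n) a b"
proof (cases "a = b")
  case False
  then have "dist a b < inverse (2 ^ n) \<longleftrightarrow> (2::real) ^ n < 2 ^ subdegree (a - b)"
    by (simp add: dist_fps_def)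
  also have "\<dots> \<longleftrightarrow> Suc n \<le> subdegree (a - b)"
    by (simp add: Suc_le_eq)
  also have "\<dots> \<longleftrightarrow> cong_X (Suc n) a b"
    using False unfolding cong_X_def
    by (subst fps_dvd_iff) (auto simp: fps_X_power_subdegree simp del: power_Suc)
  finally show ?thesis .
qed simp

lemma ex_inverse_power_less: "e > 0 \<Longrightarrow> \<exists>n. inverse (2 ^ n) < (e::real)"
  using real_arch_pow_inv[of e "1/2"] by (simp add: power_one_over inverse_eq_divide)

lemma continuous_on_fps_iff:
  fixes f :: "'a::field fps \<Rightarrow> 'a fps"
  shows "continuous_on UNIV f \<longleftrightarrow> (\<forall>x n. \<exists>N. \<forall>y. cong_X N y x \<longrightarrow> cong_X n (f y) (f x))"
proof
  assume cont: "continuous_on UNIV f"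
  show "\<forall>x n. \<exists>N. \<forall>y. cong_X N y x \<longrightarrow> cong_X n (f y) (f x)"
  proof (intro allI)
    fix x :: "'a fps" and n
    have "inverse (2 ^ n) > (0::real)" by simp
    with cont obtain d where d: "d > 0" "\<And>y. dist y x < d \<Longrightarrow> dist (f y) (f x) < inverse (2 ^ n)"
      unfolding continuous_on_iff by (metis UNIV_I)
    from ex_inverse_power_less[OF d(1)] obtain N where "inverse (2 ^ N) < d" ..
    then have "cong_X (Suc N) y x \<Longrightarrow> cong_X (Suc n) (f y) (f x)" for y
      using d(2)[of y] by (simp flip: dist_less_iff_cong_X)
    then show "\<exists>N. \<forall>y. cong_X N y x \<longrightarrow> cong_X n (f y) (f x)"
      by (meson cong_X_mono le_SucI order_refl)
  qed
next
  assume *: "\<forall>x n. \<exists>N. \<forall>y. cong_X N y x \<longrightarrow> cong_X n (f y) (f x)"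
  show "continuous_on UNIV f"
    unfolding continuous_on_iff
  proof (intro ballI allI impI)
    fix x :: "'a fps" and e :: real
    assume "e > 0"
    from ex_inverse_power_less[OF this] obtain n where n: "inverse (2 ^ n) < e" ..
    from * obtain N where N: "\<And>y. cong_X N y x \<Longrightarrow> cong_X (Suc n) (f y) (f x)" by meson
    have "dist (f y) (f x) < e" if "dist y x < inverse (2 ^ N)" for y
    proof -
      have "cong_X (Suc n) (f y) (f x)"
        using that by (intro N) (auto simp: dist_less_iff_cong_X intro: cong_X_mono)
      then show ?thesis using n by (simp flip: dist_less_iff_cong_X)
    qed
    then show "\<exists>d>0. \<forall>y\<in>UNIV. dist y x < d \<longrightarrow> dist (f y) (f x) < e"
      by (intro exI[of _ "inverse (2 ^ N)"]) auto
  qed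
qed

text \<open>
  The residue field being finite, power series form a compact space, so continuity is uniform. If
  uniformity failed, it would fail on the cosets of $X^k$ along some infinite branch, because each
  coset of $X^k$ splits into finitely many cosets of $X^{k+1}$; continuity at the limit of the
  branch contradicts this.
\<close>

lemma continuous_on_fps_iff_uniform:
  fixes f :: "'a::{field,finite} fps \<Rightarrow> 'a fps"
  shows "continuous_on UNIV f \<longleftrightarrow> (\<forall>n. \<exists>N. \<forall>x y. cong_X N x y \<longrightarrow> cong_X n (f x) (f y))"
proof
  assume cont: "continuous_on UNIV f"
  show "\<forall>n. \<exists>N. \<forall>x y. cong_X N x y \<longrightarrow> cong_X n (f x) (f y)"
  proof (rule allI, rule ccontr)
    fix n
    define good where
      "good k x \<longleftrightarrow> (\<exists>N. \<forall>y z. cong_X k y x \<longrightarrow> cong_X N y z \<longrightarrow> cong_X n (f y) (f z))" for k x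
    assume "\<nexists>N. \<forall>x y. cong_X N x y \<longrightarrow> cong_X n (f x) (f y)"
    then have bad0: "\<not> good 0 0" by (simp add: good_def)
    have step: "\<exists>x'. \<not> good (Suc k) x' \<and> cong_X k x' x" if "\<not> good k x" for k x
    proof (rule ccontr)
      assume none: "\<not> ?thesis"
      define child where "child a = Abs_fps (\<lambda>i. if i = k then a else x $ i)" for a
      have "cong_X k (child a) x" for a
        by (simp add: cong_X_iff_nth child_def)
      with none have "good (Suc k) (child a)" for a by blast
      then obtain N where N: "\<And>a y z. cong_X (Suc k) y (child a) \<Longrightarrow> cong_X (N a) y z
          \<Longrightarrow> cong_X n (f y) (f z)"
        unfolding good_def by metis
      have "cong_X n (f y) (f z)" if y: "cong_X k y x" and z: "cong_X (Max (range N)) y z" for y z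
      proof (rule N)
        show "cong_X (Suc k) y (child (y $ k))"
          using y by (auto simp: cong_X_iff_nth child_def less_Suc_eq)
        show "cong_X (N (y $ k)) y z"
          using z by (rule cong_X_mono) simp
      qed
      then have "good k x" unfolding good_def by blast
      with that show False ..
    qed
    from dependent_nat_choice[of "\<lambda>k x. \<not> good k x" "\<lambda>k x x'. cong_X k x' x"] bad0 step
    obtain s where s: "\<And>k. \<not> good k (s k)" "\<And>k. cong_X k (s (Suc k)) (s k)" by metis
    define x where "x = Abs_fps (\<lambda>j. s (Suc j) $ j)"
    have branch: "cong_X k (s (k + d)) (s k)" for k d
    proof (induction d)
      case (Suc d)
      have "cong_X k (s (Suc (k + d))) (s (k + d))"
        using s(2) by (rule cong_X_mono) simp
      with Suc show ?case by (auto intro: cong_X_trans)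
    qed simp
    have "cong_X k x (s k)" for k
      unfolding cong_X_iff_nth
    proof (intro allI impI)
      fix j assume "j < k"
      with branch[of "Suc j" "k - Suc j"] show "x $ j = s k $ j"
        by (simp add: x_def cong_X_iff_nth)
    qed
    then have bad: "\<not> good k x" for k
      using s(1)[of k] unfolding good_def by (meson cong_X_trans cong_X_sym)
    from cont obtain N where "\<And>y. cong_X N y x \<Longrightarrow> cong_X n (f y) (f x)"
      unfolding continuous_on_fps_iff by meson
    then have "good N x"
      unfolding good_def by (meson cong_X_trans cong_X_sym)
    with bad show False by blast
  qed
next
  assume "\<forall>n. \<exists>N. \<forall>x y. cong_X N x y \<longrightarrow> cong_X n (f x) (f y)"
  then show "continuous_on UNIV f"
    unfolding continuous_on_fps_iff by meson
qed

lemma continuous_on_fps_add: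
  fixes f g :: "'a::field fps \<Rightarrow> 'a fps"
  assumes "continuous_on UNIV f" "continuous_on UNIV g"
  shows "continuous_on UNIV (\<lambda>x. f x + g x)"
  unfolding continuous_on_fps_iff
proof (intro allI)
  fix x n
  from assms obtain M N where "\<And>y. cong_X M y x \<Longrightarrow> cong_X n (f y) (f x)"
    and "\<And>y. cong_X N y x \<Longrightarrow> cong_X n (g y) (g x)"
    unfolding continuous_on_fps_iff by meson
  then show "\<exists>N. \<forall>y. cong_X N y x \<longrightarrow> cong_X n (f y + g y) (f x + g x)"
    by (meson cong_X_add cong_X_mono max.cobounded1 max.cobounded2)
qed

lemma continuous_on_fps_mult:
  fixes f g :: "'a::field fps \<Rightarrow> 'a fps"
  assumes "continuous_on UNIV f" "continuous_on UNIV g"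
  shows "continuous_on UNIV (\<lambda>x. f x * g x)"
  unfolding continuous_on_fps_iff
proof (intro allI)
  fix x n
  from assms obtain M N where "\<And>y. cong_X M y x \<Longrightarrow> cong_X n (f y) (f x)"
    and "\<And>y. cong_X N y x \<Longrightarrow> cong_X n (g y) (g x)"
    unfolding continuous_on_fps_iff by meson
  then show "\<exists>N. \<forall>y. cong_X N y x \<longrightarrow> cong_X n (f y * g y) (f x * g x)"
    by (meson cong_X_mult cong_X_mono max.cobounded1 max.cobounded2)
qed

lemma continuous_on_fps_power:
  fixes f :: "'a::field fps \<Rightarrow> 'a fps"
  shows "continuous_on UNIV f \<Longrightarrow> continuous_on UNIV (\<lambda>x. f x ^ m)"
  by (induction m) (auto intro: continuous_on_fps_mult)

lemma continuous_on_fps_sum: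
  fixes f :: "'i \<Rightarrow> 'a::field fps \<Rightarrow> 'a fps"
  shows "(\<And>i. i \<in> A \<Longrightarrow> continuous_on UNIV (f i)) \<Longrightarrow> continuous_on UNIV (\<lambda>x. \<Sum>i\<in>A. f i x)"
  by (induction A rule: infinite_finite_induct) (auto intro: continuous_on_fps_add)

lemma continuous_on_fps_prod:
  fixes f :: "'i \<Rightarrow> 'a::field fps \<Rightarrow> 'a fps"
  shows "(\<And>i. i \<in> A \<Longrightarrow> continuous_on UNIV (f i)) \<Longrightarrow> continuous_on UNIV (\<lambda>x. \<Prod>i\<in>A. f i x)"
  by (induction A rule: infinite_finite_induct) (auto intro: continuous_on_fps_mult)

lemma continuous_on_fps_translate:
  fixes f :: "'a::field fps \<Rightarrow> 'a fps"
  assumes "continuous_on UNIV f"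
  shows "continuous_on UNIV (\<lambda>y. f (x + y))"
proof -
  have "cong_X N (x + y) (x + z) \<longleftrightarrow> cong_X N y z" for N y z
    by (simp add: cong_X_def)
  then show ?thesis
    using assms unfolding continuous_on_fps_iff by metis
qed

section \<open>Measures\<close>

text \<open>
  Linearity, stated for plain continuous functions so that no values of \<open>apply_bcontfun\<close> occur in
  calculations. A linear functional is automatically continuous (\<open>R_measures_eq\<close>).
\<close>

definition R_linear :: "'a::field functional \<Rightarrow> bool" where
  "R_linear \<mu> \<longleftrightarrow>
     (\<forall>a b f g. continuous_on UNIV f \<longrightarrow> continuous_on UNIV g \<longrightarrow>
        \<mu> (Bcontfun (\<lambda>x. a * f x + b * g x)) = a * \<mu> (Bcontfun f) + b * \<mu> (Bcontfun g))"

lemma continuous_on_fps_cancel: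
  fixes h :: "'a::field fps \<Rightarrow> 'a fps"
  assumes "continuous_on UNIV (\<lambda>x. fps_X ^ n * h x)"
  shows "continuous_on UNIV h"
  using assms unfolding continuous_on_fps_iff by (metis cong_X_mult_X_power_iff)

lemma continuous_on_fps_lincomb:
  fixes f g :: "'a::field fps \<Rightarrow> 'a fps"
  assumes "continuous_on UNIV f" "continuous_on UNIV g"
  shows "continuous_on UNIV (\<lambda>x. a * f x + b * g x)"
  using assms by (intro continuous_on_fps_add continuous_on_fps_mult) auto

text \<open>
  A linear functional is a contraction: it maps a function that is divisible by $X^n$, which is
  $X^n$ times a continuous function, to a multiple of $X^n$.
\<close>

lemma R_linear_cong_X:
  fixes \<mu> :: "'a::field functional"
  assumes \<mu>: "R_linear \<mu>" and f: "continuous_on UNIV f" and g: "continuous_on UNIV g"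
    and fg: "\<And>x. cong_X n (f x) (g x)"
  shows "cong_X n (\<mu> (Bcontfun f)) (\<mu> (Bcontfun g))"
proof -
  from fg have "\<forall>x. \<exists>c. f x = g x + fps_X ^ n * c" by (metis cong_XE)
  then obtain h where h: "\<And>x. f x = g x + fps_X ^ n * h x" by metis
  then have f_eq: "f = (\<lambda>x. 1 * g x + fps_X ^ n * h x)" by auto
  have "(\<lambda>x. fps_X ^ n * h x) = (\<lambda>x. 1 * f x + (-1) * g x)" by (simp add: h)
  then have "continuous_on UNIV (\<lambda>x. fps_X ^ n * h x)"
    using continuous_on_fps_lincomb[OF f g, of 1 "-1"] by (simp only:)
  then have "continuous_on UNIV h" by (rule continuous_on_fps_cancel)
  with \<mu> g have "\<mu> (Bcontfun f) = 1 * \<mu> (Bcontfun g) + fps_X ^ n * \<mu> (Bcontfun h)"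
    unfolding R_linear_def f_eq by blast
  then show ?thesis by (simp add: cong_X_def)
qed

lemma R_measures_eq: "R_measures = {\<mu> :: 'a::field functional. R_linear \<mu>}"
proof (intro Set.set_eqI iffI CollectI)
  fix \<mu> :: "'a functional"
  assume "\<mu> \<in> R_measures"
  then have *: "\<mu> (Bcontfun (\<lambda>x. a * apply_bcontfun f x + b * apply_bcontfun g x)) = a * \<mu> f + b * \<mu> g"
    for a b f g by (simp add: R_measures_def)
  show "R_linear \<mu>"
    unfolding R_linear_def
  proof (intro allI impI)
    fix a b and f g :: "'a fps \<Rightarrow> 'a fps"
    assume "continuous_on UNIV f" "continuous_on UNIV g"
    then show "\<mu> (Bcontfun (\<lambda>x. a * f x + b * g x)) = a * \<mu> (Bcontfun f) + b * \<mu> (Bcontfun g)"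
      using *[of a "Bcontfun f" b "Bcontfun g"] by (simp add: apply_Bcontfun_fps)
  qed
next
  fix \<mu> :: "'a functional"
  assume "\<mu> \<in> Collect R_linear"
  then have \<mu>: "R_linear \<mu>" by simp
  have "continuous_on UNIV \<mu>"
    unfolding continuous_on_iff
  proof (intro ballI allI impI)
    fix f :: "'a fps \<Rightarrow>\<^sub>C 'a fps" and e :: real
    assume "e > 0"
    from ex_inverse_power_less[OF this] obtain n where n: "inverse (2 ^ n) < e" ..
    have "dist (\<mu> g) (\<mu> f) < e" if "dist g f < inverse (2 ^ n)" for g
    proof -
      have "cong_X (Suc n) (apply_bcontfun g x) (apply_bcontfun f x)" for x
        using dist_fun_lt_imp_dist_val_lt[OF that, of x] by (simp add: dist_less_iff_cong_X)
      then have "cong_X (Suc n) (\<mu> (Bcontfun (apply_bcontfun g))) (\<mu> (Bcontfun (apply_bcontfun f)))"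
        using \<mu> by (intro R_linear_cong_X) auto
      then have "dist (\<mu> g) (\<mu> f) < inverse (2 ^ n)"
        by (simp add: apply_bcontfun_inverse dist_less_iff_cong_X)
      with n show ?thesis by simp
    qed
    then show "\<exists>d>0. \<forall>g\<in>UNIV. dist g f < d \<longrightarrow> dist (\<mu> g) (\<mu> f) < e"
      by (intro exI[of _ "inverse (2 ^ n)"]) auto
  qed
  moreover have "\<mu> (Bcontfun (\<lambda>x. a * apply_bcontfun f x + b * apply_bcontfun g x)) = a * \<mu> f + b * \<mu> g"
    for a b f g
  proof -
    have "\<mu> (Bcontfun (\<lambda>x. a * apply_bcontfun f x + b * apply_bcontfun g x)) =
        a * \<mu> (Bcontfun (apply_bcontfun f)) + b * \<mu> (Bcontfun (apply_bcontfun g))"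
      by (rule \<mu>[unfolded R_linear_def, rule_format]) auto
    then show ?thesis by (simp add: apply_bcontfun_inverse)
  qed
  ultimately show "\<mu> \<in> R_measures" by (simp add: R_measures_def)
qed

lemma measure_eqI:
  assumes "\<And>f. continuous_on UNIV f \<Longrightarrow> \<mu> (Bcontfun f) = \<nu> (Bcontfun f)"
  shows "(\<mu> :: 'a::field functional) = \<nu>"
proof
  fix f show "\<mu> f = \<nu> f"
    using assms[of "apply_bcontfun f"] by (simp add: apply_bcontfun_inverse)
qed

context
  fixes \<mu> :: "'a::field functional"
  assumes \<mu>: "\<mu> \<in> R_measures"
begin

lemma measure_lincomb:
  "continuous_on UNIV f \<Longrightarrow> continuous_on UNIV g \<Longrightarrow>
     \<mu> (Bcontfun (\<lambda>x. a * f x + b * g x)) = a * \<mu> (Bcontfun f) + b * \<mu> (Bcontfun g)"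
  using \<mu> by (simp add: R_measures_eq R_linear_def)

lemma measure_zero: "\<mu> (Bcontfun (\<lambda>x. 0)) = 0"
  using measure_lincomb[of "\<lambda>x. 0" "\<lambda>x. 0" 0 0] by simp

lemma measure_sum:
  assumes "finite A" "\<And>i. i \<in> A \<Longrightarrow> continuous_on UNIV (f i)"
  shows "\<mu> (Bcontfun (\<lambda>x. \<Sum>i\<in>A. c i * f i x)) = (\<Sum>i\<in>A. c i * \<mu> (Bcontfun (f i)))"
  using assms
proof (induction A)
  case (insert i A)
  have "continuous_on UNIV (\<lambda>x. \<Sum>i\<in>A. c i * f i x)"
    using insert.prems by (intro continuous_on_fps_sum continuous_on_fps_mult) auto
  from measure_lincomb[OF insert.prems[of i] this, of "c i" 1] insert show ?case by simp
qed (simp add: measure_zero)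

lemma measure_cong_X:
  "continuous_on UNIV f \<Longrightarrow> continuous_on UNIV g \<Longrightarrow> (\<And>x. cong_X n (f x) (g x)) \<Longrightarrow>
     cong_X n (\<mu> (Bcontfun f)) (\<mu> (Bcontfun g))"
  using \<mu> by (intro R_linear_cong_X) (simp_all add: R_measures_eq)

end

text \<open>
  If \<open>f\<close> is uniformly continuous, its translates by two nearby points are uniformly close, and a
  measure is a contraction; so the inner integral of a convolution is again a continuous function.
\<close>

lemma continuous_on_partial_integral:
  fixes \<nu> :: "'a::{field,finite} functional"
  assumes \<nu>: "\<nu> \<in> R_measures" and f: "continuous_on UNIV f"
  shows "continuous_on UNIV (\<lambda>x. \<nu> (Bcontfun (\<lambda>y. f (x + y))))"
  unfolding continuous_on_fps_iff_uniform
proof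
  fix n
  from f obtain N where N: "\<And>x y. cong_X N x y \<Longrightarrow> cong_X n (f x) (f y)"
    unfolding continuous_on_fps_iff_uniform by meson
  have "cong_X n (\<nu> (Bcontfun (\<lambda>y. f (x + y)))) (\<nu> (Bcontfun (\<lambda>y. f (x' + y))))"
    if "cong_X N x x'" for x x'
    using that by (intro measure_cong_X[OF \<nu>] continuous_on_fps_translate[OF f] N cong_X_add) auto
  then show "\<exists>N. \<forall>x x'. cong_X N x x' \<longrightarrow>
      cong_X n (\<nu> (Bcontfun (\<lambda>y. f (x + y)))) (\<nu> (Bcontfun (\<lambda>y. f (x' + y))))"
    by blast
qed

lemma convolution_Bcontfun:
  fixes \<mu> \<nu> :: "'a::field functional"
  assumes "continuous_on UNIV f"
  shows "convolution \<mu> \<nu> (Bcontfun f) = \<mu> (Bcontfun (\<lambda>x. \<nu> (Bcontfun (\<lambda>y. f (x + y)))))"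
  using assms by (simp add: convolution_def apply_Bcontfun_fps)

lemma convolution_in_R_measures:
  fixes \<mu> \<nu> :: "'a::{field,finite} functional"
  assumes \<mu>: "\<mu> \<in> R_measures" and \<nu>: "\<nu> \<in> R_measures"
  shows "convolution \<mu> \<nu> \<in> R_measures"
  unfolding R_measures_eq mem_Collect_eq R_linear_def
  by (simp add: convolution_Bcontfun continuous_on_fps_lincomb continuous_on_fps_translate
      measure_lincomb[OF \<nu>] measure_lincomb[OF \<mu>] continuous_on_partial_integral[OF \<nu>])

lemma dirac_in_R_measures: "(\<lambda>f. apply_bcontfun f 0) \<in> (R_measures :: 'a::field functional set)"
  unfolding R_measures_eq mem_Collect_eq R_linear_def
  by (simp add: apply_Bcontfun_fps continuous_on_fps_lincomb)

lemma zero_in_R_measures: "(\<lambda>f. 0) \<in> (R_measures :: 'a::field functional set)"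
  unfolding R_measures_eq mem_Collect_eq R_linear_def by simp

lemma add_in_R_measures:
  "\<mu> \<in> R_measures \<Longrightarrow> \<nu> \<in> R_measures \<Longrightarrow> (\<lambda>f. \<mu> f + \<nu> f) \<in> (R_measures :: 'a::field functional set)"
  unfolding R_measures_eq mem_Collect_eq R_linear_def by (simp add: algebra_simps)

lemma smult_in_R_measures:
  "\<mu> \<in> R_measures \<Longrightarrow> (\<lambda>f. a * \<mu> f) \<in> (R_measures :: 'a::field functional set)"
  unfolding R_measures_eq mem_Collect_eq R_linear_def by (simp add: algebra_simps)

lemma convolution_assoc:
  fixes \<mu> \<nu> \<kappa> :: "'a::{field,finite} functional"
  assumes "\<mu> \<in> R_measures" "\<nu> \<in> R_measures" "\<kappa> \<in> R_measures"
  shows "convolution (convolution \<mu> \<nu>) \<kappa> = convolution \<mu> (convolution \<nu> \<kappa>)"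
  by (rule measure_eqI)
    (simp add: convolution_Bcontfun continuous_on_fps_translate continuous_on_partial_integral assms
      add.assoc)

lemma convolution_dirac_left:
  "convolution (\<lambda>f. apply_bcontfun f 0) \<mu> = (\<mu> :: 'a::{field,finite} functional)"
  if "\<mu> \<in> R_measures"
  by (rule measure_eqI)
    (simp add: convolution_Bcontfun apply_Bcontfun_fps continuous_on_partial_integral that)

lemma convolution_smult_left:
  "convolution (\<lambda>f. a * \<mu> f) \<nu> = (\<lambda>f. a * convolution \<mu> \<nu> f)" for \<mu> :: "'a::field functional"
  by (simp add: convolution_def)

lemma convolution_add_left:
  "convolution (\<lambda>f. \<mu> f + \<mu>' f) \<nu> = (\<lambda>f. convolution \<mu> \<nu> f + convolution \<mu>' \<nu> f)"
  for \<mu> :: "'a::field functional"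
  by (simp add: convolution_def)

section \<open>Functions whose residues form a basis\<close>

text \<open>
  Modulo the maximal ideal, an orthonormal basis becomes a basis of the space of locally constant
  functions with values in the residue field. Conversely this property of the residues lifts, power
  by power, to statements modulo every $X^n$, and these determine a measure by its values on the
  basis and allow the values to be prescribed.
\<close>

locale residue_basis =
  fixes G :: "nat \<Rightarrow> 'a::{field,finite} fps \<Rightarrow> 'a fps"
  assumes continuous: "continuous_on UNIV (G t)"
    and residue_independent:
      "(\<And>x. cong_X 1 (\<Sum>t<N. a t * G t x) 0) \<Longrightarrow> t < N \<Longrightarrow> cong_X 1 (a t) 0"
    and residue_spanning:
      "continuous_on UNIV f \<Longrightarrow> \<exists>N a. \<forall>x. cong_X 1 (f x) (\<Sum>t<N. a t * G t x)"
begin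

lemma continuous_sum: "continuous_on UNIV (\<lambda>x. \<Sum>t<N. a t * G t x)"
  by (intro continuous_on_fps_sum continuous_on_fps_mult continuous continuous_on_const)

text \<open>
  Once all coefficients are known to be divisible by $X^n$, dividing the relation by $X^n$ leaves a
  relation modulo $X$.
\<close>

lemma independent_mod_X_power:
  assumes "\<And>x. cong_X n (\<Sum>t<N. a t * G t x) 0" and "t < N"
  shows "cong_X n (a t) 0"
  using assms
proof (induction n arbitrary: t)
  case (Suc n)
  have "cong_X n (a t) 0" if "t < N" for t
    using that by (intro Suc.IH cong_X_mono[OF Suc.prems(1)]) auto
  then have "\<forall>t. \<exists>c. t < N \<longrightarrow> a t = fps_X ^ n * c"
    by (metis cong_XE add_0)
  then obtain b where b: "\<And>t. t < N \<Longrightarrow> a t = fps_X ^ n * b t"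
    by metis
  have "cong_X 1 (\<Sum>t<N. b t * G t x) 0" for x
  proof -
    have "(\<Sum>t<N. a t * G t x) = fps_X ^ n * (\<Sum>t<N. b t * G t x)"
      by (simp add: b sum_distrib_left mult.assoc)
    with Suc.prems(1)[of x] show ?thesis
      using cong_X_mult_X_power_iff[of n 1 "\<Sum>t<N. b t * G t x" 0] by simp
  qed
  then have "cong_X 1 (b t) 0"
    using Suc.prems(2) by (rule residue_independent)
  then show ?case
    using b[OF Suc.prems(2)] cong_X_mult_X_power_iff[of n 1 "b t" 0] by simp
qed simp

text \<open>
  The difference of \<open>f\<close> and an expansion modulo $X$ is $X$ times a continuous function, which can be
  expanded modulo $X^n$ in turn.
\<close>

lemma spanning_mod_X_power:
  assumes "continuous_on UNIV f"
  shows "\<exists>N a. \<forall>x. cong_X n (f x) (\<Sum>t<N. a t * G t x)"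
  using assms
proof (induction n arbitrary: f)
  case (Suc n)
  obtain N a where a: "\<And>x. cong_X 1 (f x) (\<Sum>t<N. a t * G t x)"
    using residue_spanning[OF Suc.prems] by blast
  then have "\<forall>x. \<exists>c. f x = (\<Sum>t<N. a t * G t x) + fps_X ^ 1 * c" by (metis cong_XE)
  then obtain h where h: "\<And>x. f x = (\<Sum>t<N. a t * G t x) + fps_X ^ 1 * h x" by metis
  have "(\<lambda>x. fps_X ^ 1 * h x) = (\<lambda>x. 1 * f x + (-1) * (\<Sum>t<N. a t * G t x))" by (simp add: h)
  then have "continuous_on UNIV (\<lambda>x. fps_X ^ 1 * h x)"
    using continuous_on_fps_lincomb[OF Suc.prems continuous_sum, of 1 "-1"] by (simp only:)
  then have "continuous_on UNIV h" by (rule continuous_on_fps_cancel)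
  from Suc.IH[OF this] obtain M b where b: "\<And>x. cong_X n (h x) (\<Sum>t<M. b t * G t x)" by blast
  define c where "c t = (if t < N then a t else 0) + fps_X * (if t < M then b t else 0)" for t
  have "cong_X (Suc n) (f x) (\<Sum>t<max N M. c t * G t x)" for x
  proof -
    have ext: "(\<Sum>t<max N M. (if t < K then d t else 0) * G t x) = (\<Sum>t<K. d t * G t x)"
      if "K \<le> max N M" for K d
      using that by (intro sum.mono_neutral_cong_right) auto
    have "(\<Sum>t<max N M. c t * G t x) = (\<Sum>t<N. a t * G t x) + fps_X * (\<Sum>t<M. b t * G t x)"
      by (simp add: c_def distrib_right sum.distrib mult.assoc ext flip: sum_distrib_left)
    moreover have "cong_X (Suc n) (fps_X * h x) (fps_X * (\<Sum>t<M. b t * G t x))"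
      using b[of x] cong_X_mult_X_power_iff[of 1 n "h x" "\<Sum>t<M. b t * G t x"] by simp
    ultimately show ?thesis
      by (simp add: h cong_X_add)
  qed
  then show ?case by blast
qed simp

lemma measure_eq_if_eq_on_basis:
  assumes \<mu>: "\<mu> \<in> R_measures" and \<nu>: "\<nu> \<in> R_measures"
    and eq: "\<And>t. \<mu> (Bcontfun (G t)) = \<nu> (Bcontfun (G t))"
  shows "\<mu> = \<nu>"
proof (rule measure_eqI)
  fix f :: "'a fps \<Rightarrow> 'a fps"
  assume f: "continuous_on UNIV f"
  show "\<mu> (Bcontfun f) = \<nu> (Bcontfun f)"
  proof (rule eq_if_cong_X)
    fix n
    obtain N a where a: "\<And>x. cong_X n (f x) (\<Sum>t<N. a t * G t x)"
      using spanning_mod_X_power[OF f] by blast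
    have "cong_X n (\<mu> (Bcontfun f)) (\<mu> (Bcontfun (\<lambda>x. \<Sum>t<N. a t * G t x)))"
      by (intro measure_cong_X[OF \<mu>] f continuous_sum a)
    also have "\<mu> (Bcontfun (\<lambda>x. \<Sum>t<N. a t * G t x)) = \<nu> (Bcontfun (\<lambda>x. \<Sum>t<N. a t * G t x))"
      by (simp add: measure_sum[OF \<mu>] measure_sum[OF \<nu>] continuous eq)
    also have "cong_X n \<dots> (\<nu> (Bcontfun f))"
      by (intro measure_cong_X[OF \<nu>] f continuous_sum cong_X_sym[OF a])
    finally show "cong_X n (\<mu> (Bcontfun f)) (\<nu> (Bcontfun f))" .
  qed
qed

text \<open>
  The measure with prescribed values \<open>b\<close> is the limit of its values on finite linear combinations:
  if $f \<equiv> \sum_t a_t G_t$ modulo $X^n$, then its value at $f$ modulo $X^n$ has to be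
  $\sum_t a_t b_t$, which by independence depends on $f$ only.
\<close>

definition approximates :: "(nat \<Rightarrow> 'a fps) \<Rightarrow> nat \<Rightarrow> ('a fps \<Rightarrow> 'a fps) \<Rightarrow> 'a fps \<Rightarrow> bool" where
  "approximates b n f r \<longleftrightarrow>
     (\<exists>N a. (\<forall>x. cong_X n (f x) (\<Sum>t<N. a t * G t x)) \<and> cong_X n r (\<Sum>t<N. a t * b t))"

lemma approximates_lincomb:
  assumes "approximates b n f r" "approximates b n g s"
  shows "approximates b n (\<lambda>x. u * f x + v * g x) (u * r + v * s)"
proof -
  obtain N a where a: "\<And>x. cong_X n (f x) (\<Sum>t<N. a t * G t x)" "cong_X n r (\<Sum>t<N. a t * b t)"
    using assms(1) unfolding approximates_def by blast
  obtain M c where c: "\<And>x. cong_X n (g x) (\<Sum>t<M. c t * G t x)" "cong_X n s (\<Sum>t<M. c t * b t)"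
    using assms(2) unfolding approximates_def by blast
  define d where "d t = u * (if t < N then a t else 0) + v * (if t < M then c t else 0)" for t
  have ext: "(\<Sum>t<max N M. (if t < K then d t else 0) * h t) = (\<Sum>t<K. d t * h t)"
    if "K \<le> max N M" for K and d h :: "nat \<Rightarrow> 'a fps"
    using that by (intro sum.mono_neutral_cong_right) auto
  have d: "(\<Sum>t<max N M. d t * h t) = u * (\<Sum>t<N. a t * h t) + v * (\<Sum>t<M. c t * h t)" for h
    by (simp add: d_def distrib_right sum.distrib mult.assoc ext flip: sum_distrib_left)
  show ?thesis
    unfolding approximates_def
    by (intro exI[of _ "max N M"] exI[of _ d] conjI allI) (simp_all add: d cong_X_add cong_X_mult a c)
qed

lemma approximates_zero:
  assumes "approximates b n (\<lambda>x. 0) r"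
  shows "cong_X n r 0"
proof -
  obtain N a where a: "\<And>x. cong_X n 0 (\<Sum>t<N. a t * G t x)" and r: "cong_X n r (\<Sum>t<N. a t * b t)"
    using assms unfolding approximates_def by blast
  have "cong_X n (\<Sum>t<N. a t * b t) (\<Sum>t<N. 0 * b t)"
    using independent_mod_X_power[OF cong_X_sym[OF a]] by (intro cong_X_sum cong_X_mult) auto
  with r show ?thesis by (auto intro: cong_X_trans)
qed

lemma approximates_unique:
  assumes "approximates b n f r" "approximates b n f s"
  shows "cong_X n r s"
  using approximates_zero[of b n "1 * r + (-1) * s"] approximates_lincomb[OF assms, of 1 "-1"]
  by (simp add: cong_X_def)

lemma ex_limit_value:
  assumes "continuous_on UNIV f"
  shows "\<exists>r. \<forall>n. approximates b n f r"
proof -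
  have "\<exists>r. approximates b n f r" for n
    using spanning_mod_X_power[OF assms, of n] unfolding approximates_def
    by (metis cong_X_refl)
  then obtain r where r: "\<And>n. approximates b n f (r n)" by metis
  have coherent: "cong_X m (r m) (r n)" if "m \<le> n" for m n
  proof -
    have "approximates b m f (r n)"
      using r[of n] that unfolding approximates_def by (meson cong_X_mono)
    with r show ?thesis by (rule approximates_unique)
  qed
  define l where "l = Abs_fps (\<lambda>k. r (Suc k) $ k)"
  have "cong_X n l (r n)" for n
    using coherent by (fastforce simp: cong_X_iff_nth l_def)
  then have "approximates b n f l" for n
    using r[of n] unfolding approximates_def by (meson cong_X_trans)
  then show ?thesis by blast
qed

text \<open>
  Approximate values are compatible with linear combinations and unique, so their limits form a
  linear functional.
\<close>

theorem ex1_measure_with_values: "\<exists>!\<mu>. \<mu> \<in> R_measures \<and> (\<forall>t. \<mu> (Bcontfun (G t)) = b t)"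
proof (rule ex_ex1I)
  define \<mu> where "\<mu> f = (SOME r. \<forall>n. approximates b n (apply_bcontfun f) r)" for f
  have approx: "approximates b n f (\<mu> (Bcontfun f))" if "continuous_on UNIV f" for f n
  proof -
    have "\<forall>n. approximates b n (apply_bcontfun (Bcontfun f)) (\<mu> (Bcontfun f))"
      unfolding \<mu>_def by (rule someI_ex) (rule ex_limit_value, simp)
    then show ?thesis using that by (simp add: apply_Bcontfun_fps)
  qed
  have "R_linear \<mu>"
    unfolding R_linear_def
    by (intro allI impI eq_if_cong_X approximates_unique[OF approx approximates_lincomb]
        approx continuous_on_fps_lincomb)
  moreover have "\<mu> (Bcontfun (G t)) = b t" for t
  proof (rule eq_if_cong_X)
    fix n
    have "approximates b n (G t) (b t)"
      unfolding approximates_def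
      by (intro exI[of _ "Suc t"] exI[of _ "\<lambda>s. if s = t then 1 else 0"])
        (simp add: if_distrib[of "\<lambda>c. c * _"] cong: if_cong)
    with approx[OF continuous] show "cong_X n (\<mu> (Bcontfun (G t))) (b t)"
      by (rule approximates_unique)
  qed
  ultimately show "\<exists>\<mu>. \<mu> \<in> R_measures \<and> (\<forall>t. \<mu> (Bcontfun (G t)) = b t)"
    unfolding R_measures_eq by blast
qed (auto intro: measure_eq_if_eq_on_basis)

end

section \<open>Digits and digit products\<close>

definition digit :: "nat \<Rightarrow> nat \<Rightarrow> nat \<Rightarrow> nat" where
  "digit p t i = t div p ^ i mod p"

text \<open>
  For $v_i = e_i(x)$ and base $q$ this is the value $G_t(x)$ of the digit expansion. Leaving the
  sequence \<open>v\<close> and its ring free allows the same product to be used for residues, for indeterminate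
  values in a finite field, and for the base $p$.
\<close>

definition digit_prod :: "nat \<Rightarrow> (nat \<Rightarrow> 'b::comm_monoid_mult) \<Rightarrow> nat \<Rightarrow> 'b" where
  "digit_prod p v t = (\<Prod>i | digit p t i \<noteq> 0. v i ^ digit p t i)"

lemma digit_0 [simp]: "digit p t 0 = t mod p"
  and digit_of_0 [simp]: "digit p 0 i = 0"
  by (simp_all add: digit_def)

lemma digit_Suc: "digit p t (Suc i) = digit p (t div p) i"
  by (simp add: digit_def div_mult2_eq)

lemma digit_less: "p \<ge> 2 \<Longrightarrow> digit p t i < p"
  by (simp add: digit_def)

lemma digit_eq_0:
  assumes "t < p ^ n" "n \<le> i"
  shows "digit p t i = 0"
proof (cases "p = 0")
  case True
  with assms(1) have "t = 0" by (cases n) auto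
  then show ?thesis by simp
next
  case False
  with assms(2) have "p ^ n \<le> p ^ i" by (intro power_increasing) auto
  with assms(1) show ?thesis by (simp add: digit_def)
qed

lemma less_base_power: "p \<ge> 2 \<Longrightarrow> t < p ^ t" for p t :: nat
  using less_exp[of t] power_mono[of 2 p t] by linarith

lemma digit_eq_0_self: "p \<ge> 2 \<Longrightarrow> t \<le> i \<Longrightarrow> digit p t i = 0"
  by (rule digit_eq_0[OF less_base_power])

lemma finite_nonzero_digits: "p \<ge> 2 \<Longrightarrow> finite {i. digit p t i \<noteq> 0}"
proof (rule finite_subset)
  assume p: "p \<ge> 2"
  show "{i. digit p t i \<noteq> 0} \<subseteq> {..<t}"
  proof
    fix i assume "i \<in> {i. digit p t i \<noteq> 0}"
    then show "i \<in> {..<t}" using digit_eq_0_self[OF p, of t i] by (cases "t \<le> i") simp_all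
  qed
qed simp

text \<open>
  A number with last digit removed is smaller unless it is $0$; and if all digits vanish, the number
  is divisible by every power of the base.
\<close>

lemma digit_eqI:
  assumes "p \<ge> 2" "\<And>i. digit p s i = digit p t i"
  shows "s = t"
  using assms(2)
proof (induction s arbitrary: t rule: less_induct)
  case (less s)
  have mod: "s mod p = t mod p" using less.prems[of 0] by simp
  have digits: "digit p (s div p) i = digit p (t div p) i" for i
    using less.prems[of "Suc i"] by (simp add: digit_Suc)
  have "s div p = t div p"
  proof (cases "s = 0")
    case True
    have "t = 0"
    proof (rule ccontr)
      assume "t \<noteq> 0"
      obtain k where k: "t < p ^ k" using less_base_power assms(1) by blast
      have "t mod p ^ n = 0" for n
      proof (induction n)
        case (Suc n)
        have "t div p ^ n mod p = 0" using less.prems[of n] True by (simp add: digit_def)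
        with Suc show ?case using mod_mult2_eq[of t "p ^ n" p] by (simp only: power_Suc2)
      qed simp
      from this[of k] k \<open>t \<noteq> 0\<close> show False by simp
    qed
    with True show ?thesis by simp
  next
    case False
    with assms(1) have "s div p < s" by simp
    then show ?thesis using digits by (rule less.IH)
  qed
  with mod show ?case by (metis div_mult_mod_eq)
qed

lemma digit_add_mult:
  assumes "a < p"
  shows "digit p (a + p * s) 0 = a" "digit p (a + p * s) (Suc i) = digit p s i"
  using assms by (simp_all add: digit_Suc)

lemma sum_digits_less:
  fixes d :: "nat \<Rightarrow> nat"
  assumes "\<And>i. d i < p"
  shows "(\<Sum>i<n. d i * p ^ i) < p ^ n"
proof (induction n)
  case (Suc n)
  have "(\<Sum>i<Suc n. d i * p ^ i) < p ^ n + d n * p ^ n" using Suc by simp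
  also have "\<dots> = Suc (d n) * p ^ n" by simp
  also have "\<dots> \<le> p * p ^ n" using assms[of n] by (intro mult_right_mono) auto
  finally show ?case by simp
qed simp

lemma digit_sum:
  fixes d :: "nat \<Rightarrow> nat"
  assumes "\<And>i. d i < p"
  shows "digit p (\<Sum>i<n. d i * p ^ i) i = (if i < n then d i else 0)"
  using assms
proof (induction n arbitrary: d i)
  case (Suc n)
  have "(\<Sum>i<Suc n. d i * p ^ i) = d 0 + p * (\<Sum>i<n. d (Suc i) * p ^ i)"
    by (subst sum.lessThan_Suc_shift) (simp add: sum_distrib_left mult_ac)
  then show ?case
    using Suc.prems by (cases i) (simp_all add: digit_add_mult Suc.IH del: digit_0 sum.lessThan_Suc)
qed simp

lemma sum_digits: "(\<Sum>i<n. digit p t i * p ^ i) = t mod p ^ n"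
proof (induction n)
  case (Suc n)
  then show ?case
    using mod_mult2_eq[of t "p ^ n" p] by (simp only: power_Suc2) (simp add: digit_def mult.commute)
qed simp

lemma digit_prod_eq:
  assumes "finite A" "\<And>i. i \<notin> A \<Longrightarrow> digit p t i = 0"
  shows "digit_prod p v t = (\<Prod>i\<in>A. v i ^ digit p t i)"
proof -
  have "{i. digit p t i \<noteq> 0} \<subseteq> A"
    using assms(2) by (metis (mono_tags) mem_Collect_eq subsetI)
  with assms(1) show ?thesis
    unfolding digit_prod_def by (intro prod.mono_neutral_left) auto
qed

lemma digit_prod_0 [simp]: "digit_prod p v 0 = 1"
  by (simp add: digit_prod_def)

lemma digit_prod_rec:
  assumes "p \<ge> 2"
  shows "digit_prod p v t = v 0 ^ (t mod p) * digit_prod p (\<lambda>i. v (Suc i)) (t div p)"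
proof -
  have t: "digit p (t div p) i = 0" if "t \<le> i" for i
    using assms order_trans[OF div_le_dividend that] by (intro digit_eq_0_self) auto
  have "digit_prod p v t = (\<Prod>i<Suc t. v i ^ digit p t i)"
    using assms by (intro digit_prod_eq digit_eq_0_self) auto
  also have "\<dots> = v 0 ^ (t mod p) * (\<Prod>i<t. v (Suc i) ^ digit p (t div p) i)"
    by (subst prod.lessThan_Suc_shift) (simp add: digit_Suc)
  also have "(\<Prod>i<t. v (Suc i) ^ digit p (t div p) i) = digit_prod p (\<lambda>i. v (Suc i)) (t div p)"
    using t by (intro digit_prod_eq[symmetric]) auto
  finally show ?thesis .
qed

lemma digit_prod_add_mult:
  assumes "p \<ge> 2" "a < p"
  shows "digit_prod p v (a + p * s) = v 0 ^ a * digit_prod p (\<lambda>i. v (Suc i)) s"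
  using assms by (subst digit_prod_rec) simp_all

lemma digit_prod_cong:
  fixes v w :: "nat \<Rightarrow> 'b::comm_monoid_mult"
  assumes "t < p ^ n" "\<And>i. i < n \<Longrightarrow> v i = w i"
  shows "digit_prod p v t = digit_prod p w t"
proof -
  have eq: "digit_prod p u t = (\<Prod>i<n. u i ^ digit p t i)" for u :: "nat \<Rightarrow> 'b"
    using assms(1) by (intro digit_prod_eq digit_eq_0) auto
  show ?thesis unfolding eq using assms(2) by (intro prod.cong) auto
qed

lemma digit_prod_split:
  assumes "p \<ge> 2"
  shows "digit_prod p v t = (\<Prod>i<n. v i ^ digit p t i) * digit_prod p (\<lambda>i. v (i + n)) (t div p ^ n)"
proof (induction n)
  case (Suc n)
  have "digit_prod p (\<lambda>i. v (i + n)) (t div p ^ n) =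
      v n ^ digit p t n * digit_prod p (\<lambda>i. v (i + Suc n)) (t div p ^ Suc n)"
    by (subst digit_prod_rec[OF assms]) (simp add: digit_def div_mult2_eq mult.commute[of p])
  with Suc show ?case by (simp add: mult.assoc)
qed simp

text \<open>Each digit for the base $p^m$ is spelled out by $m$ digits for the base $p$.\<close>

lemma digit_prod_power_base:
  assumes "p \<ge> 2" "m \<ge> 1"
  shows "digit_prod (p ^ m) v t = digit_prod p (\<lambda>l. v (l div m) ^ p ^ (l mod m)) t"
proof (induction t arbitrary: v rule: less_induct)
  case (less t)
  have pm: "p ^ m \<ge> 2"
    using assms self_le_power[of p m] by linarith
  show ?case
  proof (cases "t = 0")
    case False
    have "(\<Prod>i<m. (v (i div m) ^ p ^ (i mod m)) ^ digit p t i) = (\<Prod>i<m. v 0 ^ (digit p t i * p ^ i))"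
      by (intro prod.cong) (simp_all add: mult.commute flip: power_mult)
    also have "\<dots> = v 0 ^ (t mod p ^ m)"
      by (simp add: sum_digits flip: power_sum)
    finally have first: "(\<Prod>i<m. (v (i div m) ^ p ^ (i mod m)) ^ digit p t i) = v 0 ^ (t mod p ^ m)" .
    have "digit_prod (p ^ m) v t = v 0 ^ (t mod p ^ m) * digit_prod (p ^ m) (\<lambda>i. v (Suc i)) (t div p ^ m)"
      by (rule digit_prod_rec[OF pm])
    also have "digit_prod (p ^ m) (\<lambda>i. v (Suc i)) (t div p ^ m) =
        digit_prod p (\<lambda>l. v (Suc (l div m)) ^ p ^ (l mod m)) (t div p ^ m)"
      using pm False by (intro less.IH) auto
    also have "\<dots> = digit_prod p (\<lambda>l. v ((l + m) div m) ^ p ^ ((l + m) mod m)) (t div p ^ m)"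
      using assms(2) by simp
    finally show ?thesis
      by (subst digit_prod_split[OF assms(1), of _ _ m]) (simp only: first)
  qed simp
qed

section \<open>Reduced monomials as functions on a finite field\<close>

lemma sum_by_residue:
  fixes q Q :: nat
  assumes "q > 0"
  shows "(\<Sum>t<q * Q. f t) = (\<Sum>a<q. \<Sum>s<Q. f (a + q * s))"
proof -
  have "a + q * s < q * Q" if "a < q" "s < Q" for a s
  proof -
    have "a + q * s < q * Suc s" using that by simp
    also have "\<dots> \<le> q * Q" using that by (intro mult_le_mono2) simp
    finally show ?thesis .
  qed
  then have "(\<Sum>t<q * Q. f t) = (\<Sum>(a, s)\<in>{..<q} \<times> {..<Q}. f (a + q * s))"
    using assms
    by (intro sum.reindex_bij_witness[of _ "\<lambda>(a, s). a + q * s" "\<lambda>t. (t mod q, t div q)"])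
      (auto simp: less_mult_imp_div_less mult.commute[of q])
  then show ?thesis by (simp add: sum.cartesian_product)
qed

lemma card_finite_field_ge_2: "CARD('a::{field,finite}) \<ge> 2"
  using card_mono[of "UNIV :: 'a set" "{0, 1}"] by simp

text \<open>
  A polynomial in one variable of degree less than $q$ that vanishes on the whole field of $q$
  elements is zero; the digits of \<open>t\<close> are split off one by one.
\<close>

lemma digit_prod_independent:
  fixes c :: "nat \<Rightarrow> 'a::{field,finite}"
  assumes "\<And>v. (\<Sum>t<CARD('a) ^ n. c t * digit_prod (CARD('a)) v t) = 0" and "t < CARD('a) ^ n"
  shows "c t = 0"
  using assms
proof (induction n arbitrary: c t)
  case 0
  then show ?case by simp
next
  case (Suc n)
  define q where "q = CARD('a)"
  have q: "q \<ge> 2" unfolding q_def by (rule card_finite_field_ge_2)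
  have slice: "(\<Sum>s<q ^ n. c (a + q * s) * digit_prod q w s) = 0" if a: "a < q" for a w
  proof -
    define b where "b a = (\<Sum>s<q ^ n. c (a + q * s) * digit_prod q w s)" for a
    define P where "P = (\<Sum>a<q. monom (b a) a)"
    have "poly P x = 0" for x
    proof -
      define v where "v i = (case i of 0 \<Rightarrow> x | Suc j \<Rightarrow> w j)" for i
      have "digit_prod q v (a + q * s) = x ^ a * digit_prod q w s" if "a < q" for a s
        using that by (simp add: digit_prod_add_mult[OF q] v_def)
      then have "(\<Sum>t<q ^ Suc n. c t * digit_prod q v t) = poly P x"
        using q by (simp add: sum_by_residue P_def b_def poly_sum poly_monom sum_distrib_left
            sum_distrib_right mult_ac)
      then show ?thesis using Suc.prems(1)[of v] by (simp add: q_def)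
    qed
    moreover have "degree P < q"
      unfolding P_def using q by (intro degree_sum_less) (auto intro: le_less_trans[OF degree_monom_le])
    ultimately have "P = 0"
      using card_poly_roots_bound[of P] by (auto simp: q_def)
    moreover have "coeff P a = b a"
      using a by (simp add: P_def coeff_sum)
    ultimately show ?thesis by (simp add: b_def)
  qed
  have "c (t mod q + q * (t div q)) = 0"
  proof (rule Suc.IH[where c = "\<lambda>s. c (t mod q + q * s)"])
    show "(\<Sum>s<CARD('a) ^ n. c (t mod q + q * s) * digit_prod (CARD('a)) w s) = 0" for w
      using slice[of "t mod q" w] q by (simp add: q_def)
    show "t div q < CARD('a) ^ n"
      using Suc.prems(2) by (simp add: q_def less_mult_imp_div_less mult.commute)
  qed
  then show ?case by simp
qed

text \<open>
  There are $q^{q^n}$ functions on $k^n$ with values in the field $k$ of $q$ elements, and as many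
  linear combinations of the $q^n$ reduced monomials, which are pairwise different as functions.
\<close>

lemma digit_prod_interpolation:
  fixes F :: "(nat \<Rightarrow> 'a::{field,finite}) \<Rightarrow> 'a"
  assumes F: "\<And>v w. (\<And>i. i < n \<Longrightarrow> v i = w i) \<Longrightarrow> F v = F w"
  shows "\<exists>c. \<forall>v. F v = (\<Sum>t<CARD('a) ^ n. c t * digit_prod (CARD('a)) v t)"
proof -
  define q where "q = CARD('a)"
  define V where "V = {..<n} \<rightarrow>\<^sub>E (UNIV :: 'a set)"
  define C where "C = {..<q ^ n} \<rightarrow>\<^sub>E (UNIV :: 'a set)"
  define \<Phi> where "\<Phi> c = restrict (\<lambda>v. \<Sum>t<q ^ n. c t * digit_prod q v t) V" for c
  have restrict: "(\<Sum>t<q ^ n. c t * digit_prod q (restrict v {..<n}) t) =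
      (\<Sum>t<q ^ n. c t * digit_prod q v t)" for c and v :: "nat \<Rightarrow> 'a"
    by (intro sum.cong arg_cong2[of _ _ _ _ "(*)"] digit_prod_cong[of _ q n]) auto
  have V: "restrict v {..<n} \<in> V" for v by (simp add: V_def)
  have finV: "finite V" unfolding V_def by (intro finite_PiE) auto
  have "inj_on \<Phi> C"
  proof (rule inj_onI)
    fix c d assume cd: "c \<in> C" "d \<in> C" "\<Phi> c = \<Phi> d"
    have "(\<Sum>t<q ^ n. (c t - d t) * digit_prod q v t) = 0" for v
      using fun_cong[OF cd(3), of "restrict v {..<n}"] V[of v]
      by (simp add: \<Phi>_def restrict left_diff_distrib sum_subtractf)
    then have "c t - d t = 0" if "t < q ^ n" for t
      using that unfolding q_def by (intro digit_prod_independent[where c = "\<lambda>t. c t - d t"])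
    then show "c = d"
      using cd(1,2) unfolding C_def by (intro PiE_ext) auto
  qed
  then have "card (\<Phi> ` C) = card C" by (rule card_image)
  also have "\<dots> = card (V \<rightarrow>\<^sub>E (UNIV :: 'a set))"
    using finV by (simp add: C_def V_def card_PiE q_def)
  finally have "\<Phi> ` C = V \<rightarrow>\<^sub>E UNIV"
    using finV by (intro card_subset_eq finite_PiE) (auto simp: \<Phi>_def)
  moreover have "restrict F V \<in> V \<rightarrow>\<^sub>E UNIV" by simp
  ultimately obtain c where c: "restrict F V = \<Phi> c" by (metis imageE)
  have "F v = (\<Sum>t<q ^ n. c t * digit_prod q v t)" for v
  proof -
    have "F v = F (restrict v {..<n})" by (rule F) simp
    also have "\<dots> = \<Phi> c (restrict v {..<n})" using V[of v] fun_cong[OF c] by (metis restrict_apply')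
    finally show ?thesis using V[of v] by (simp add: \<Phi>_def restrict)
  qed
  then show ?thesis unfolding q_def by blast
qed

section \<open>Addition formula and permutation of digits\<close>

definition dominated :: "nat \<Rightarrow> nat \<Rightarrow> nat set" where
  "dominated p t = {s. \<forall>i. digit p s i \<le> digit p t i}"

text \<open>
  By Lucas's theorem this is, modulo a prime \<open>p\<close>, the binomial coefficient \<open>t choose s\<close>. The product
  form makes it evident that the order of the digits does not matter.
\<close>

definition digit_binom :: "nat \<Rightarrow> nat \<Rightarrow> nat \<Rightarrow> nat" where
  "digit_binom p t s = (\<Prod>i | digit p t i \<noteq> 0. digit p t i choose digit p s i)"

lemma dominated_rec:
  assumes "p \<ge> 2"
  shows "dominated p t = (\<lambda>(a, s). a + p * s) ` ({..t mod p} \<times> dominated p (t div p))"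
proof (intro equalityI subsetI)
  fix s assume s: "s \<in> dominated p t"
  have "digit p (s div p) i \<le> digit p (t div p) i" for i
    using s by (simp add: dominated_def flip: digit_Suc)
  moreover have "s mod p \<le> t mod p"
    using s by (auto simp: dominated_def dest!: spec[of _ 0])
  ultimately have "(s mod p, s div p) \<in> {..t mod p} \<times> dominated p (t div p)"
    by (simp add: dominated_def)
  then show "s \<in> (\<lambda>(a, s). a + p * s) ` ({..t mod p} \<times> dominated p (t div p))"
    by (rule rev_image_eqI) simp
next
  fix s assume "s \<in> (\<lambda>(a, s). a + p * s) ` ({..t mod p} \<times> dominated p (t div p))"
  then obtain a s' where s: "s = a + p * s'" "a \<le> t mod p" "s' \<in> dominated p (t div p)" by auto
  have "a < p" using s(2) assms by (meson le_less_trans mod_less_divisor pos2 less_le_trans)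
  have "digit p s i \<le> digit p t i" for i
    using s \<open>a < p\<close> by (cases i) (auto simp: digit_add_mult digit_Suc dominated_def)
  then show "s \<in> dominated p t" by (simp add: dominated_def)
qed

lemma dominatedE:
  assumes "p \<ge> 2" "s \<in> dominated p t"
  obtains a s' where "s = a + p * s'" "a \<le> t mod p" "a < p" "s' \<in> dominated p (t div p)"
proof -
  from assms obtain a s' where s: "s = a + p * s'" "a \<le> t mod p" "s' \<in> dominated p (t div p)"
    unfolding dominated_rec[OF assms(1), of t] by auto
  moreover have "t mod p < p" using assms(1) by simp
  ultimately show ?thesis using that by simp
qed

lemma dominated_0: "p \<ge> 2 \<Longrightarrow> dominated p 0 = {0}"
  by (auto simp: dominated_def intro: digit_eqI)

lemma dominated_le:
  assumes "p \<ge> 2"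
  shows "s \<in> dominated p t \<Longrightarrow> s \<le> t"
proof (induction t arbitrary: s rule: less_induct)
  case (less t)
  show ?case
  proof (cases "t = 0")
    case True
    with less.prems assms show ?thesis by (simp add: dominated_0)
  next
    case False
    from dominatedE[OF assms less.prems] obtain a s'
      where s: "s = a + p * s'" "a \<le> t mod p" "s' \<in> dominated p (t div p)" .
    have "s' \<le> t div p" using s(3) False assms by (intro less.IH) auto
    then have "a + p * s' \<le> t mod p + p * (t div p)" using s(2) by (intro add_mono) auto
    then show ?thesis using s(1) by simp
  qed
qed

lemma finite_dominated: "p \<ge> 2 \<Longrightarrow> finite (dominated p t)"
  by (rule finite_subset[of _ "{..t}"]) (auto dest: dominated_le)

lemma diff_by_residue:
  fixes p t a s :: nat
  assumes "a \<le> t mod p" "s \<le> t div p"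
  shows "t - (a + p * s) = (t mod p - a) + p * (t div p - s)"
proof -
  have "t - (a + p * s) = (t mod p + p * (t div p)) - (a + p * s)" by simp
  also have "\<dots> = (t mod p - a) + p * (t div p - s)"
    using assms by (simp add: diff_mult_distrib2)
  finally show ?thesis .
qed

lemma digit_diff:
  assumes "p \<ge> 2" "s \<in> dominated p t"
  shows "digit p (t - s) i = digit p t i - digit p s i"
  using assms(2)
proof (induction i arbitrary: s t)
  case 0
  from dominatedE[OF assms(1) 0] obtain a s'
    where s: "s = a + p * s'" "a \<le> t mod p" "a < p" "s' \<in> dominated p (t div p)" .
  have "t - s = (t mod p - a) + p * (t div p - s')"
    using s dominated_le[OF assms(1)] by (simp add: diff_by_residue)
  moreover have "t mod p - a < p" using assms(1) by (simp add: less_imp_diff_less)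
  ultimately have "digit p (t - s) 0 = t mod p - a"
    by (simp only: digit_add_mult)
  with s show ?case by simp
next
  case (Suc i)
  from dominatedE[OF assms(1) Suc.prems] obtain a s'
    where s: "s = a + p * s'" "a \<le> t mod p" "a < p" "s' \<in> dominated p (t div p)" .
  have "t - s = (t mod p - a) + p * (t div p - s')"
    using s dominated_le[OF assms(1)] by (simp add: diff_by_residue)
  moreover have "t mod p - a < p" using assms(1) by (simp add: less_imp_diff_less)
  ultimately have "digit p (t - s) (Suc i) = digit p (t div p - s') i"
    by (simp add: digit_add_mult)
  with Suc.IH[OF s(4)] s(1,3) show ?case by (simp add: digit_add_mult digit_Suc[of p t])
qed

lemma digit_binom_eq:
  assumes "s \<in> dominated p t" "finite A" "\<And>i. i \<notin> A \<Longrightarrow> digit p t i = 0"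
  shows "digit_binom p t s = (\<Prod>i\<in>A. digit p t i choose digit p s i)"
  unfolding digit_binom_def
proof (rule prod.mono_neutral_left)
  show "\<forall>i\<in>A - {i. digit p t i \<noteq> 0}. (digit p t i choose digit p s i) = 1"
  proof
    fix i assume "i \<in> A - {i. digit p t i \<noteq> 0}"
    moreover have "digit p s i \<le> digit p t i" using assms(1) by (simp add: dominated_def)
    ultimately show "(digit p t i choose digit p s i) = 1" by simp
  qed
  show "{i. digit p t i \<noteq> 0} \<subseteq> A"
    using assms(3) by (metis (mono_tags) mem_Collect_eq subsetI)
qed (rule assms(2))

lemma digit_binom_rec:
  assumes "p \<ge> 2" "a \<le> t mod p" "s \<in> dominated p (t div p)"
  shows "digit_binom p t (a + p * s) = (t mod p choose a) * digit_binom p (t div p) s"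
proof -
  have "t mod p < p" using assms(1) by simp
  with assms(2) have a: "a < p" by simp
  have t: "digit p (t div p) i = 0" if "t \<le> i" for i
    using assms(1) order_trans[OF div_le_dividend that] by (intro digit_eq_0_self) auto
  have "a + p * s \<in> dominated p t"
    using assms by (auto simp: dominated_rec[of p t])
  then have "digit_binom p t (a + p * s) =
      (\<Prod>i<Suc t. digit p t i choose digit p (a + p * s) i)"
    using assms(1) by (intro digit_binom_eq digit_eq_0_self) auto
  also have "\<dots> = (t mod p choose a) * (\<Prod>i<t. digit p (t div p) i choose digit p s i)"
    using a by (subst prod.lessThan_Suc_shift) (simp add: digit_add_mult digit_Suc[of p t])
  also have "(\<Prod>i<t. digit p (t div p) i choose digit p s i) = digit_binom p (t div p) s"
    using t assms(3) by (intro digit_binom_eq[symmetric]) auto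
  finally show ?thesis .
qed

text \<open>The binomial theorem in each digit.\<close>

theorem digit_prod_add:
  fixes v w :: "nat \<Rightarrow> 'b::comm_semiring_1"
  assumes p: "p \<ge> 2"
  shows "digit_prod p (\<lambda>i. v i + w i) t =
    (\<Sum>s\<in>dominated p t. of_nat (digit_binom p t s) * digit_prod p v s * digit_prod p w (t - s))"
proof (induction t arbitrary: v w rule: less_induct)
  case (less t)
  show ?case
  proof (cases "t = 0")
    case True
    then show ?thesis using p by (simp add: dominated_0 digit_binom_def)
  next
    case False
    let ?v = "\<lambda>i. v (Suc i)" and ?w = "\<lambda>i. w (Suc i)"
    have tp: "t mod p < p" using p by simp
    have inj: "inj_on (\<lambda>(a, s). a + p * s) ({..t mod p} \<times> dominated p (t div p))"
      by (rule inj_on_inverseI[where g = "\<lambda>s. (s mod p, s div p)"]) (use tp in auto)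
    have "digit_prod p (\<lambda>i. v i + w i) t =
        (v 0 + w 0) ^ (t mod p) * digit_prod p (\<lambda>i. ?v i + ?w i) (t div p)"
      by (rule digit_prod_rec[OF p])
    also have "digit_prod p (\<lambda>i. ?v i + ?w i) (t div p) =
        (\<Sum>s\<in>dominated p (t div p).
          of_nat (digit_binom p (t div p) s) * digit_prod p ?v s * digit_prod p ?w (t div p - s))"
      using False p by (intro less.IH) auto
    also have "(v 0 + w 0) ^ (t mod p) =
        (\<Sum>a\<le>t mod p. of_nat (t mod p choose a) * v 0 ^ a * w 0 ^ (t mod p - a))"
      by (rule binomial_ring)
    also have "\<dots> * (\<Sum>s\<in>dominated p (t div p).
          of_nat (digit_binom p (t div p) s) * digit_prod p ?v s * digit_prod p ?w (t div p - s)) =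
        (\<Sum>(a, s)\<in>{..t mod p} \<times> dominated p (t div p).
          (of_nat (t mod p choose a) * v 0 ^ a * w 0 ^ (t mod p - a)) *
          (of_nat (digit_binom p (t div p) s) * digit_prod p ?v s * digit_prod p ?w (t div p - s)))"
      by (simp add: sum_product sum.cartesian_product)
    also have "\<dots> = (\<Sum>(a, s)\<in>{..t mod p} \<times> dominated p (t div p).
        of_nat (digit_binom p t (a + p * s)) * digit_prod p v (a + p * s) *
        digit_prod p w (t - (a + p * s)))"
    proof (rule sum.cong[OF refl], safe)
      fix a s assume as: "a \<le> t mod p" "s \<in> dominated p (t div p)"
      have a: "a < p" and a': "t mod p - a < p" using as(1) tp by auto
      have "digit_prod p v (a + p * s) = v 0 ^ a * digit_prod p ?v s"
        using p a by (rule digit_prod_add_mult)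
      moreover have "digit_prod p w (t - (a + p * s)) =
          w 0 ^ (t mod p - a) * digit_prod p ?w (t div p - s)"
        unfolding diff_by_residue[OF as(1) dominated_le[OF p as(2)]] by (rule digit_prod_add_mult[OF p a'])
      ultimately show "(of_nat (t mod p choose a) * v 0 ^ a * w 0 ^ (t mod p - a)) *
          (of_nat (digit_binom p (t div p) s) * digit_prod p ?v s * digit_prod p ?w (t div p - s)) =
        of_nat (digit_binom p t (a + p * s)) * digit_prod p v (a + p * s) *
        digit_prod p w (t - (a + p * s))"
        using as by (simp add: digit_binom_rec[OF p] mult_ac)
    qed
    also have "\<dots> = (\<Sum>s\<in>dominated p t.
        of_nat (digit_binom p t s) * digit_prod p v s * digit_prod p w (t - s))"
      unfolding dominated_rec[OF p, of t] sum.reindex[OF inj] by (simp add: case_prod_unfold)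
    finally show ?thesis .
  qed
qed

text \<open>
  The map induced on the nonnegative integers by the element of $S_{(p)}$ that belongs to \<open>\<rho>\<close>; it is
  characterised by \<open>digit_permute_digits\<close> below.
\<close>

definition permute_digits :: "nat \<Rightarrow> (nat \<Rightarrow> nat) \<Rightarrow> nat \<Rightarrow> nat" where
  "permute_digits p \<rho> t = (\<Sum>i | digit p t i \<noteq> 0. digit p t i * p ^ \<rho> i)"

lemma digit_permute_digits:
  assumes p: "p \<ge> 2" and \<rho>: "bij \<rho>"
  shows "digit p (permute_digits p \<rho> t) (\<rho> i) = digit p t i"
proof -
  define S where "S = {i. digit p t i \<noteq> 0}"
  have S: "finite S" unfolding S_def using p by (rule finite_nonzero_digits)
  obtain M where M: "\<rho> ` S \<subseteq> {..<M}"
    using finite_nat_bounded[of "\<rho> ` S"] S by auto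
  have [simp]: "inv_into UNIV \<rho> (\<rho> i) = i" for i using \<rho> by (simp add: bij_is_inj)
  have off: "digit p t (inv_into UNIV \<rho> j) = 0" if "j \<notin> \<rho> ` S" for j
  proof -
    have "j = \<rho> (inv_into UNIV \<rho> j)" using \<rho> by (simp add: bij_is_surj surj_f_inv_f)
    with that have "inv_into UNIV \<rho> j \<notin> S" by auto
    then show ?thesis by (simp add: S_def)
  qed
  have "permute_digits p \<rho> t = (\<Sum>j\<in>\<rho> ` S. digit p t (inv_into UNIV \<rho> j) * p ^ j)"
    using \<rho> by (subst sum.reindex) (auto simp: permute_digits_def S_def intro: inj_on_subset dest: bij_is_inj)
  also have "\<dots> = (\<Sum>j<M. digit p t (inv_into UNIV \<rho> j) * p ^ j)"
    using M off by (intro sum.mono_neutral_left) auto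
  finally have "digit p (permute_digits p \<rho> t) (\<rho> i) = (if \<rho> i < M then digit p t i else 0)"
    using p by (simp add: digit_sum digit_less)
  moreover have "digit p t i = 0" if "\<not> \<rho> i < M" using that M by (auto simp: S_def)
  ultimately show ?thesis by auto
qed

lemma permute_digits_eqI:
  assumes "p \<ge> 2" "bij \<rho>" "\<And>i. digit p s (\<rho> i) = digit p t i"
  shows "permute_digits p \<rho> t = s"
proof (rule digit_eqI[OF assms(1)])
  fix j
  have "j = \<rho> (inv_into UNIV \<rho> j)" using assms(2) by (simp add: bij_is_surj surj_f_inv_f)
  then show "digit p (permute_digits p \<rho> t) j = digit p s j"
    using digit_permute_digits[OF assms(1,2)] assms(3) by metis
qed

lemma permute_digits_comp:
  assumes "p \<ge> 2" "bij \<rho>" "bij \<tau>"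
  shows "permute_digits p (\<rho> \<circ> \<tau>) t = permute_digits p \<rho> (permute_digits p \<tau> t)"
  using assms by (intro permute_digits_eqI) (simp_all add: bij_comp digit_permute_digits)

lemma permute_digits_id: "p \<ge> 2 \<Longrightarrow> permute_digits p id t = t"
  by (intro permute_digits_eqI) simp_all

lemma bij_inv_comp:
  fixes \<rho> :: "'b \<Rightarrow> 'b"
  assumes "bij \<rho>"
  shows "bij (inv_into UNIV \<rho>)" "inv_into UNIV \<rho> \<circ> \<rho> = id" "\<rho> \<circ> inv_into UNIV \<rho> = id"
  using assms by (simp_all add: bij_imp_bij_inv bij_is_inj bij_is_surj surj_iff[symmetric])

lemma bij_permute_digits:
  assumes p: "p \<ge> 2" and \<rho>: "bij \<rho>"
  shows "bij (permute_digits p \<rho>)"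
proof (rule o_bij)
  note inv = bij_inv_comp[OF \<rho>]
  show "permute_digits p (inv_into UNIV \<rho>) \<circ> permute_digits p \<rho> = id"
    by (rule ext) (simp only: comp_apply id_apply inv(2) permute_digits_id[OF p]
        permute_digits_comp[OF p inv(1) \<rho>, symmetric])
  show "permute_digits p \<rho> \<circ> permute_digits p (inv_into UNIV \<rho>) = id"
    by (rule ext) (simp only: comp_apply id_apply inv(3) permute_digits_id[OF p]
        permute_digits_comp[OF p \<rho> inv(1), symmetric])
qed

lemma dominated_permute_digits:
  assumes p: "p \<ge> 2" and \<rho>: "bij \<rho>"
  shows "dominated p (permute_digits p \<rho> t) = permute_digits p \<rho> ` dominated p t"
proof -
  have iff: "permute_digits p \<rho> s \<in> dominated p (permute_digits p \<rho> t) \<longleftrightarrow> s \<in> dominated p t" for s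
  proof -
    have "permute_digits p \<rho> s \<in> dominated p (permute_digits p \<rho> t) \<longleftrightarrow>
        (\<forall>i. digit p (permute_digits p \<rho> s) (\<rho> i) \<le> digit p (permute_digits p \<rho> t) (\<rho> i))"
      unfolding dominated_def mem_Collect_eq using bij_is_surj[OF \<rho>] by (metis surjD)
    then show ?thesis using p \<rho> by (simp add: dominated_def digit_permute_digits)
  qed
  have "surj (permute_digits p \<rho>)" using bij_permute_digits[OF p \<rho>] by (rule bij_is_surj)
  then have "dominated p (permute_digits p \<rho> t) =
      permute_digits p \<rho> ` (permute_digits p \<rho> -` dominated p (permute_digits p \<rho> t))"
    by (simp add: image_vimage_eq)
  also have "permute_digits p \<rho> -` dominated p (permute_digits p \<rho> t) = dominated p t"
    using iff by (simp add: vimage_def)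
  finally show ?thesis .
qed

lemma permute_digits_diff:
  assumes p: "p \<ge> 2" and \<rho>: "bij \<rho>" and s: "s \<in> dominated p t"
  shows "permute_digits p \<rho> (t - s) = permute_digits p \<rho> t - permute_digits p \<rho> s"
proof (rule permute_digits_eqI[OF p \<rho>])
  have "permute_digits p \<rho> s \<in> dominated p (permute_digits p \<rho> t)"
    using s by (simp add: dominated_permute_digits[OF p \<rho>])
  then show "digit p (permute_digits p \<rho> t - permute_digits p \<rho> s) (\<rho> i) = digit p (t - s) i" for i
    using p \<rho> s by (simp add: digit_diff digit_permute_digits)
qed

lemma digit_binom_permute_digits:
  assumes p: "p \<ge> 2" and \<rho>: "bij \<rho>"
  shows "digit_binom p (permute_digits p \<rho> t) (permute_digits p \<rho> s) = digit_binom p t s"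
proof -
  let ?\<sigma> = "permute_digits p \<rho>"
  have supp: "{j. digit p (?\<sigma> t) j \<noteq> 0} = \<rho> ` {i. digit p t i \<noteq> 0}"
  proof (intro equalityI subsetI)
    fix j assume j: "j \<in> {j. digit p (?\<sigma> t) j \<noteq> 0}"
    have "j = \<rho> (inv_into UNIV \<rho> j)" using \<rho> by (simp add: bij_is_surj surj_f_inv_f)
    with j show "j \<in> \<rho> ` {i. digit p t i \<noteq> 0}"
      using digit_permute_digits[OF p \<rho>] by (metis imageI mem_Collect_eq)
  qed (use p \<rho> in \<open>auto simp: digit_permute_digits\<close>)
  have inj: "inj_on \<rho> {i. digit p t i \<noteq> 0}" using \<rho> by (meson bij_is_inj inj_on_subset subset_UNIV)
  show ?thesis
    unfolding digit_binom_def supp prod.reindex[OF inj] using p \<rho> by (simp add: digit_permute_digits)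
qed

section \<open>The digit principle\<close>

text \<open>
  What the residues of an orthonormal basis of the linear functions retain: they are linearly
  independent over the residue field, and the coefficients of a power series are finite linear
  combinations of them.
\<close>

locale linear_residue_basis =
  fixes E :: "nat \<Rightarrow> 'a::{field,finite} fps \<Rightarrow> 'a fps"
  assumes continuous_E: "continuous_on UNIV (E i)"
    and E_add: "E i (x + y) = E i x + E i y"
    and E_scale: "E i (fps_const b * x) = fps_const b * E i x"
    and coordinates: "\<exists>n c. \<forall>x. x $ j = (\<Sum>i<n. c i * E i x $ 0)"
    and linearly_independent: "(\<And>x. (\<Sum>i<n. c i * E i x $ 0) = 0) \<Longrightarrow> i < n \<Longrightarrow> c i = 0"
begin

lemma E_lincomb: "E i (\<Sum>j\<in>A. fps_const (b j) * x j) = (\<Sum>j\<in>A. fps_const (b j) * E i (x j))"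
proof (induction A rule: infinite_finite_induct)
  case (insert j A)
  then show ?case by (simp add: E_add E_scale)
qed (use E_scale[of i 0 0] in simp_all)

text \<open>
  Gaussian elimination for linearly independent functionals: in the induction, \<open>d\<close> is dual to the
  first \<open>n\<close> functionals; the next one is not a combination of these, so it is nonzero at some \<open>z\<close>
  where the first \<open>n\<close> vanish, and adding a multiple of \<open>z\<close> corrects its value alone.
\<close>

lemma residues_surjective: "\<exists>x. \<forall>i<n. E i x $ 0 = v i"
proof (induction n arbitrary: v)
  case (Suc n)
  have "\<exists>x. \<forall>i<n. E i x $ 0 = (if i = j then 1 else 0)" for j by (rule Suc.IH)
  then obtain d where d: "\<And>i j. i < n \<Longrightarrow> E i (d j) $ 0 = (if i = j then 1 else 0)" by metis
  obtain y where y: "E n y $ 0 \<noteq> (\<Sum>j<n. E n (d j) $ 0 * E j y $ 0)"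
  proof (rule ccontr)
    assume "\<not> thesis"
    with that have eq: "E n y $ 0 = (\<Sum>j<n. E n (d j) $ 0 * E j y $ 0)" for y by blast
    define c where "c i = (if i = n then 1 else - E n (d i) $ 0)" for i
    have "(\<Sum>i<Suc n. c i * E i y $ 0) = 0" for y
      by (simp add: c_def eq[of y] sum_negf)
    then have "c n = 0" by (rule linearly_independent) simp
    then show False by (simp add: c_def)
  qed
  define z where "z = y + fps_const (-1) * (\<Sum>j<n. fps_const (E j y $ 0) * d j)"
  have z: "E i z $ 0 = E i y $ 0 - (\<Sum>j<n. E j y $ 0 * E i (d j) $ 0)" for i
    by (simp only: z_def E_add E_scale E_lincomb) (simp add: fps_sum_nth)
  have z0: "E i z $ 0 = 0" if "i < n" for i
    using that by (simp add: z d if_distrib[of "\<lambda>c. _ * c"] cong: if_cong)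
  have zn: "E n z $ 0 \<noteq> 0" using y by (simp add: z mult.commute)
  obtain x where x: "\<And>i. i < n \<Longrightarrow> E i x $ 0 = v i" using Suc.IH by blast
  define x' where "x' = x + fps_const ((v n - E n x $ 0) / E n z $ 0) * z"
  have "E i x' $ 0 = v i" if "i < Suc n" for i
    using that zn by (auto simp: x'_def E_add E_scale x z0 less_Suc_eq)
  then show ?case by blast
qed simp

definition digit_E :: "nat \<Rightarrow> 'a fps \<Rightarrow> 'a fps" where
  "digit_E t x = digit_prod (CARD('a)) (\<lambda>i. E i x) t"

lemma digit_E_nth_0: "digit_E t x $ 0 = digit_prod (CARD('a)) (\<lambda>i. E i x $ 0) t"
proof -
  have "(\<Prod>i\<in>A. f i) $ 0 = (\<Prod>i\<in>A. f i $ 0)" for A :: "nat set" and f :: "nat \<Rightarrow> 'a fps"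
    by (induction A rule: infinite_finite_induct) auto
  moreover have "(f ^ m) $ 0 = (f $ 0) ^ m" for f :: "'a fps" and m
    by (induction m) auto
  ultimately show ?thesis by (simp add: digit_E_def digit_prod_def)
qed

lemma continuous_digit_E: "continuous_on UNIV (digit_E t)"
  unfolding digit_E_def digit_prod_def
  by (intro continuous_on_fps_prod continuous_on_fps_power continuous_E)

text \<open>
  Modulo $X$, the functions $E_i$ are coordinates on the space of power series: finitely many of
  them take all combinations of values in the residue field, and together they determine every
  coefficient. So a locally constant function is a function on $k^n$ in terms of
  $E_0, \dots, E_{n-1}$, and those are the linear combinations of reduced monomials in a unique way.
\<close>

sublocale residue_basis digit_E
proof
  show "continuous_on UNIV (digit_E t)" for t by (rule continuous_digit_E)
next
  fix N a t
  assume zero: "\<And>x. cong_X 1 (\<Sum>t<N. a t * digit_E t x) 0" and t: "t < N"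
  define q where "q = CARD('a)"
  define c where "c t = (if t < N then a t $ 0 else 0)" for t
  have N: "N < q ^ N" unfolding q_def by (rule less_base_power[OF card_finite_field_ge_2])
  have "(\<Sum>t<q ^ N. c t * digit_prod q v t) = 0" for v
  proof -
    obtain x where x: "\<And>i. i < N \<Longrightarrow> E i x $ 0 = v i" using residues_surjective by blast
    have "(\<Sum>t<q ^ N. c t * digit_prod q v t) = (\<Sum>t<N. a t $ 0 * digit_prod q v t)"
      using N by (intro sum.mono_neutral_cong_right) (auto simp: c_def)
    also have "\<dots> = (\<Sum>t<N. a t $ 0 * digit_E t x $ 0)"
    proof (intro sum.cong arg_cong2[of _ _ _ _ "(*)"] refl)
      fix t assume "t \<in> {..<N}"
      with N have "t < q ^ N" by simp
      then show "digit_prod q v t = digit_E t x $ 0"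
        unfolding digit_E_nth_0 q_def[symmetric] by (rule digit_prod_cong) (simp add: x)
    qed
    also have "\<dots> = (\<Sum>t<N. a t * digit_E t x) $ 0" by (simp add: fps_sum_nth)
    also have "\<dots> = 0" using zero[of x] unfolding cong_X_1_iff by simp
    finally show ?thesis .
  qed
  then have "c t = 0"
    unfolding q_def by (rule digit_prod_independent) (use t N in \<open>simp add: q_def\<close>)
  with t show "cong_X 1 (a t) 0" unfolding cong_X_1_iff by (simp add: c_def)
next
  fix f :: "'a fps \<Rightarrow> 'a fps"
  assume "continuous_on UNIV f"
  then obtain N where N: "\<And>x y. cong_X N x y \<Longrightarrow> f x $ 0 = f y $ 0"
    unfolding continuous_on_fps_iff_uniform cong_X_1_iff[symmetric] by blast
  obtain n c where c: "\<And>x j. x $ j = (\<Sum>i<n j. c j i * E i x $ 0)" using coordinates by metis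
  define M where "M = Max (n ` {..<N})"
  have fx: "f x $ 0 = f y $ 0" if xy: "\<And>i. i < M \<Longrightarrow> E i x $ 0 = E i y $ 0" for x y
  proof (rule N)
    show "cong_X N x y"
      unfolding cong_X_iff_nth
    proof (intro allI impI)
      fix j assume "j < N"
      then have "n j \<le> M" by (auto simp: M_def)
      then show "x $ j = y $ j" unfolding c[of x] c[of y] by (intro sum.cong) (auto simp: xy)
    qed
  qed
  \<comment> \<open>A point with prescribed coordinates turns \<open>f\<close> into a function of these coordinates.\<close>
  define pt where "pt v = (SOME x. \<forall>i<M. E i x $ 0 = v i)" for v
  have pt: "E i (pt v) $ 0 = v i" if "i < M" for v i
    using someI_ex[OF residues_surjective[of M v]] that unfolding pt_def by blast
  have "f (pt v) $ 0 = f (pt w) $ 0" if "\<And>i. i < M \<Longrightarrow> v i = w i" for v w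
    using that by (intro fx) (simp add: pt)
  then obtain b where b: "\<And>v. f (pt v) $ 0 = (\<Sum>t<CARD('a) ^ M. b t * digit_prod (CARD('a)) v t)"
    using digit_prod_interpolation[of M "\<lambda>v. f (pt v) $ 0"] by blast
  have "cong_X 1 (f x) (\<Sum>t<CARD('a) ^ M. fps_const (b t) * digit_E t x)" for x
  proof -
    have "f x $ 0 = f (pt (\<lambda>i. E i x $ 0)) $ 0" by (rule fx) (simp add: pt)
    then show ?thesis unfolding cong_X_1_iff by (simp add: b fps_sum_nth digit_E_nth_0)
  qed
  then show "\<exists>N a. \<forall>x. cong_X 1 (f x) (\<Sum>t<N. a t * digit_E t x)" by (intro exI allI)
qed

end

lemma dist_fps_0_le_half: "a $ 0 = 0 \<Longrightarrow> dist a (0 :: 'a::field fps) \<le> 1 / 2"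
proof (cases "a = 0")
  case False
  assume "a $ 0 = 0"
  with False have "subdegree a \<ge> 1" by (metis One_nat_def Suc_leI gr0I nth_subdegree_nonzero)
  then have "(2::real) ^ 1 \<le> 2 ^ subdegree a" by (intro power_increasing) auto
  with False show ?thesis by (simp add: dist_fps_def field_simps)
qed simp

text \<open>
  Taking one coefficient of a power series is itself a continuous linear function, and a partial sum
  of its expansion that is closer than $1$ has the same residues. For independence, a combination of
  the $e_i$ with coefficients in the residue field that vanishes modulo $X$ has norm at most
  $\frac{1}{2}$, whereas its nonzero coefficients would have absolute value $1$.
\<close>

lemma linear_residue_basis_if_orthonormal:
  fixes e :: "nat \<Rightarrow> ('a::{field,finite} fps \<Rightarrow>\<^sub>C 'a fps)"
  assumes "orthonormal_basis linear_functions e"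
  shows "linear_residue_basis (\<lambda>i. apply_bcontfun (e i))"
proof
  from assms have e: "e i \<in> linear_functions" for i
    by (auto simp: orthonormal_basis_def)
  show "continuous_on UNIV (apply_bcontfun (e i))" for i by simp
  show add: "apply_bcontfun (e i) (x + y) = apply_bcontfun (e i) x + apply_bcontfun (e i) y" for i x y
    using e[of i] by (simp add: linear_functions_def)
  show scale: "apply_bcontfun (e i) (fps_const c * x) = fps_const c * apply_bcontfun (e i) x" for i c x
    using e[of i] by (simp add: linear_functions_def)
  have cont: "continuous_on UNIV (\<lambda>x. \<Sum>i<n. a i * apply_bcontfun (e i) x)" for a n
    by (intro continuous_on_fps_sum continuous_on_fps_mult continuous_on_const) simp
  show "\<exists>n c. \<forall>x. x $ j = (\<Sum>i<n. c i * apply_bcontfun (e i) x $ 0)" for j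
  proof -
    have "continuous_on UNIV (\<lambda>x :: 'a fps. fps_const (x $ j))"
      unfolding continuous_on_fps_iff_uniform
      by (intro allI exI[of _ "Suc j"]) (auto simp: cong_X_iff_nth)
    note coord = apply_Bcontfun_fps[OF this]
    then have "Bcontfun (\<lambda>x. fps_const (x $ j)) \<in> (linear_functions :: ('a fps \<Rightarrow>\<^sub>C 'a fps) set)"
      by (simp add: linear_functions_def)
    with assms obtain a where "expansion e a (Bcontfun (\<lambda>x. fps_const (x $ j)))"
      unfolding orthonormal_basis_def by blast
    then have "(\<lambda>n. Bcontfun (\<lambda>x. \<Sum>i<n. a i * e i x)) \<longlonglongrightarrow> Bcontfun (\<lambda>x. fps_const (x $ j))"
      by (simp add: expansion_def)
    from metric_LIMSEQ_D[OF this, of "inverse (2 ^ 0)"] obtain n where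
      n: "dist (Bcontfun (\<lambda>x. \<Sum>i<n. a i * e i x)) (Bcontfun (\<lambda>x. fps_const (x $ j))) < inverse (2 ^ 0)"
      by auto
    have "x $ j = (\<Sum>i<n. a i $ 0 * apply_bcontfun (e i) x $ 0)" for x
      using dist_fun_lt_imp_dist_val_lt[OF n, of x]
      unfolding dist_less_iff_cong_X One_nat_def[symmetric] cong_X_1_iff coord apply_Bcontfun_fps[OF cont]
      by (simp add: fps_sum_nth)
    then show ?thesis by (intro exI allI)
  qed
  fix n i and c :: "nat \<Rightarrow> 'a"
  assume zero: "\<And>x. (\<Sum>i<n. c i * apply_bcontfun (e i) x $ 0) = 0" and i: "i < n"
  define a where "a i = (if i < n then fps_const (c i) else 0)" for i
  define f where "f = Bcontfun (\<lambda>x. \<Sum>i<n. a i * e i x)"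
  have f: "apply_bcontfun f x = (\<Sum>i<n. fps_const (c i) * apply_bcontfun (e i) x)" for x
    unfolding f_def by (subst apply_Bcontfun_fps[OF cont]) (simp add: a_def)
  have "f \<in> linear_functions"
    by (simp add: linear_functions_def f add scale sum.distrib sum_distrib_left distrib_left mult.left_commute)
  moreover have "expansion e a f"
    unfolding expansion_def
  proof
    show "a \<longlonglongrightarrow> 0"
      by (rule tendsto_eventually) (auto simp: a_def eventually_sequentially intro: exI[of _ n])
    have "Bcontfun (\<lambda>x. \<Sum>i<m. a i * apply_bcontfun (e i) x) = f" if "n \<le> m" for m
      unfolding f_def using that
      by (intro arg_cong[of _ _ Bcontfun] ext sum.mono_neutral_right) (auto simp: a_def)
    then show "(\<lambda>n. Bcontfun (\<lambda>x. \<Sum>i<n. a i * apply_bcontfun (e i) x)) \<longlonglongrightarrow> f"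
      by (intro tendsto_eventually) (auto simp: eventually_sequentially)
  qed
  ultimately have norm: "dist f (const_bcontfun 0) = (SUP i. dist (a i) 0)"
    using assms unfolding orthonormal_basis_def by blast
  have "dist f (const_bcontfun 0) \<le> 1 / 2"
  proof (rule dist_bound)
    fix x
    have "apply_bcontfun f x $ 0 = 0" by (simp add: f fps_sum_nth zero)
    then show "dist (apply_bcontfun f x) (apply_bcontfun (const_bcontfun 0) x) \<le> 1 / 2"
      unfolding const_bcontfun.rep_eq by (rule dist_fps_0_le_half)
  qed
  moreover have "dist (a i) 0 \<le> (SUP i. dist (a i) 0)"
    by (rule cSUP_upper) (auto intro!: bdd_aboveI[of _ 1] simp: dist_fps_def inverse_le_1_iff)
  ultimately have "dist (a i) 0 \<le> 1 / 2" using norm by simp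
  then show "c i = 0"
    using i by (cases "c i = 0") (simp_all add: a_def dist_fps_def)
qed

section \<open>Convolution in terms of the digit expansion\<close>

lemma CHAR_eq_if_CARD_eq_prime_power:
  assumes "Factorial_Ring.prime p" "CARD('a::{field,finite}) = p ^ m"
  shows "CHAR('a) = p"
proof -
  have prime: "Factorial_Ring.prime (CHAR('a))"
    by (intro prime_CHAR_semidom finite_imp_CHAR_pos) simp
  moreover have "CHAR('a) dvd p ^ m"
    using CHAR_dvd_CARD[where 'a = 'a] assms(2) by simp
  ultimately have "CHAR('a) dvd p" by (rule prime_dvd_power)
  with prime assms(1) show ?thesis by (simp add: primes_dvd_imp_eq)
qed

locale digit_measures = linear_residue_basis E
  for E :: "nat \<Rightarrow> 'a::{field,finite} fps \<Rightarrow> 'a fps" +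
  fixes p m :: nat
  assumes prime: "Factorial_Ring.prime p" and m: "m \<ge> 1" and card: "CARD('a) = p ^ m"
begin

lemma p: "p \<ge> 2"
  using prime by (rule prime_ge_2_nat)

text \<open>
  Written with digits for the base $p$, the factors of the digit expansion are powers of the linear
  functions with exponents $p^j$. These are additive in characteristic $p$, so the binomial theorem
  in each digit gives the value at a sum.
\<close>

lemma digit_E_add:
  "digit_E t (x + y) =
    (\<Sum>s\<in>dominated p t. of_nat (digit_binom p t s) * digit_E s x * digit_E (t - s) y)"
proof -
  define F where "F x l = E (l div m) x ^ p ^ (l mod m)" for x l
  have CHAR: "CHAR('a fps) = p"
    using CHAR_eq_if_CARD_eq_prime_power[OF prime card] by simp
  have F: "digit_E t x = digit_prod p (F x) t" for t x
    unfolding digit_E_def card digit_prod_power_base[OF p m] by (simp add: F_def[abs_def])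
  have "(a + b) ^ p ^ k = a ^ p ^ k + b ^ p ^ k" for a b :: "'a fps" and k
    by (rule freshmans_dream') (simp_all add: CHAR[simplified] prime)
  then have "F (x + y) = (\<lambda>l. F x l + F y l)"
    by (simp add: F_def E_add fun_eq_iff)
  then show ?thesis
    by (simp add: F digit_prod_add[OF p])
qed

lemma convolution_digit_E:
  assumes \<mu>: "\<mu> \<in> R_measures" and \<nu>: "\<nu> \<in> R_measures"
  shows "convolution \<mu> \<nu> (Bcontfun (digit_E t)) =
    (\<Sum>s\<in>dominated p t. of_nat (digit_binom p t s) *
      \<mu> (Bcontfun (digit_E s)) * \<nu> (Bcontfun (digit_E (t - s))))"
proof -
  note fin = finite_dominated[OF p, of t]
  have "convolution \<mu> \<nu> (Bcontfun (digit_E t)) =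
      \<mu> (Bcontfun (\<lambda>x. \<nu> (Bcontfun (\<lambda>y. digit_E t (x + y)))))"
    by (rule convolution_Bcontfun) (rule continuous)
  also have "(\<lambda>x. \<nu> (Bcontfun (\<lambda>y. digit_E t (x + y)))) =
      (\<lambda>x. \<Sum>s\<in>dominated p t. (of_nat (digit_binom p t s) * digit_E s x) * \<nu> (Bcontfun (digit_E (t - s))))"
    unfolding digit_E_add by (rule ext, rule measure_sum[OF \<nu> fin continuous])
  also have "\<dots> =
      (\<lambda>x. \<Sum>s\<in>dominated p t. (of_nat (digit_binom p t s) * \<nu> (Bcontfun (digit_E (t - s)))) * digit_E s x)"
    by (simp add: mult_ac)
  also have "\<mu> (Bcontfun \<dots>) = (\<Sum>s\<in>dominated p t.
      (of_nat (digit_binom p t s) * \<nu> (Bcontfun (digit_E (t - s)))) * \<mu> (Bcontfun (digit_E s)))"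
    using fin continuous by (rule measure_sum[OF \<mu>])
  finally show ?thesis by (simp add: mult_ac)
qed

text \<open>
  Interchanging the integrals is allowed because it is for each $G_t(x + y)$, a finite sum of
  products.
\<close>

lemma convolution_comm:
  fixes \<mu> \<nu> :: "'a functional"
  assumes \<mu>: "\<mu> \<in> R_measures" and \<nu>: "\<nu> \<in> R_measures"
  shows "convolution \<mu> \<nu> = convolution \<nu> \<mu>"
proof (rule measure_eq_if_eq_on_basis)
  fix t
  note fin = finite_dominated[OF p, of t]
  have "convolution \<nu> \<mu> (Bcontfun (digit_E t)) =
      \<nu> (Bcontfun (\<lambda>x. \<mu> (Bcontfun (\<lambda>y. digit_E t (x + y)))))"
    by (rule convolution_Bcontfun) (rule continuous)
  also have "(\<lambda>x. \<mu> (Bcontfun (\<lambda>y. digit_E t (x + y)))) =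
      (\<lambda>x. \<mu> (Bcontfun (\<lambda>y. \<Sum>s\<in>dominated p t. (of_nat (digit_binom p t s) * digit_E (t - s) x) * digit_E s y)))"
    by (subst add.commute) (simp add: digit_E_add mult_ac)
  also have "\<dots> = (\<lambda>x. \<Sum>s\<in>dominated p t.
      (of_nat (digit_binom p t s) * digit_E (t - s) x) * \<mu> (Bcontfun (digit_E s)))"
    by (rule ext, rule measure_sum[OF \<mu> fin continuous])
  also have "\<dots> = (\<lambda>x. \<Sum>s\<in>dominated p t.
      (of_nat (digit_binom p t s) * \<mu> (Bcontfun (digit_E s))) * digit_E (t - s) x)"
    by (simp add: mult_ac)
  also have "\<nu> (Bcontfun \<dots>) = (\<Sum>s\<in>dominated p t.
      (of_nat (digit_binom p t s) * \<mu> (Bcontfun (digit_E s))) * \<nu> (Bcontfun (digit_E (t - s))))"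
    using fin continuous by (rule measure_sum[OF \<nu>])
  finally show "convolution \<mu> \<nu> (Bcontfun (digit_E t)) = convolution \<nu> \<mu> (Bcontfun (digit_E t))"
    by (simp add: convolution_digit_E[OF \<mu> \<nu>])
qed (intro convolution_in_R_measures \<mu> \<nu>)+

lemma algebra_measure_algebra:
  "algebra (ring_of_type_algebra :: 'a fps ring) (measure_algebra :: ('a fps, 'a functional) module)"
proof (rule algebraI)
  show "cring (ring_of_type_algebra :: 'a fps ring)" by (rule cring_from_type_algebra)
  show "cring (measure_algebra :: ('a fps, 'a functional) module)"
  proof (rule cringI)
    show "abelian_group (measure_algebra :: ('a fps, 'a functional) module)"
    proof (rule abelian_groupI)
      fix \<mu> :: "'a functional"
      assume \<mu>: "\<mu> \<in> carrier measure_algebra"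
      then show "\<exists>\<nu>\<in>carrier measure_algebra. \<nu> \<oplus>\<^bsub>measure_algebra\<^esub> \<mu> = \<zero>\<^bsub>measure_algebra\<^esub>"
        using smult_in_R_measures[of \<mu> "-1"]
        by (intro bexI[of _ "\<lambda>f. - 1 * \<mu> f"]) (simp_all add: measure_algebra_def)
    qed (auto simp: measure_algebra_def add_in_R_measures zero_in_R_measures add_ac)
    show "comm_monoid (measure_algebra :: ('a fps, 'a functional) module)"
      by (rule comm_monoidI)
        (auto simp: measure_algebra_def convolution_in_R_measures dirac_in_R_measures
          convolution_assoc convolution_dirac_left intro: convolution_comm)
  qed (simp add: measure_algebra_def convolution_add_left)
qed (auto simp: measure_algebra_def ring_of_type_algebra_def smult_in_R_measures
    convolution_smult_left algebra_simps)

section \<open>Permuting the digits of the index\<close>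

text \<open>
  Permuting digits is a bijection of the indices, so prescribing the values on
  $G_{\sigma(t)}$ is prescribing them on all of the basis.
\<close>

lemma ex1_measure_with_permuted_values:
  assumes "bij \<rho>"
  shows "\<exists>!\<nu>. \<nu> \<in> R_measures \<and> (\<forall>t. \<nu> (Bcontfun (digit_E (permute_digits p \<rho> t))) = b t)"
proof -
  let ?\<sigma> = "permute_digits p \<rho>"
  have bij: "bij ?\<sigma>" using p assms by (rule bij_permute_digits)
  have "(\<forall>t. \<nu> (Bcontfun (digit_E (?\<sigma> t))) = b t) \<longleftrightarrow>
      (\<forall>t. \<nu> (Bcontfun (digit_E t)) = b (inv_into UNIV ?\<sigma> t))" for \<nu>
    using bij by (metis bij_inv_eq_iff)
  then show ?thesis using ex1_measure_with_values by simp
qed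

definition permute_measure :: "(nat \<Rightarrow> nat) \<Rightarrow> 'a functional \<Rightarrow> 'a functional" where
  "permute_measure \<rho> \<mu> =
     (THE \<nu>. \<nu> \<in> R_measures \<and>
       (\<forall>t. \<nu> (Bcontfun (digit_E (permute_digits p \<rho> t))) = \<mu> (Bcontfun (digit_E t))))"

lemma
  assumes "bij \<rho>"
  shows permute_measure_in_R_measures: "permute_measure \<rho> \<mu> \<in> R_measures"
    and permute_measure_digit_E:
      "permute_measure \<rho> \<mu> (Bcontfun (digit_E (permute_digits p \<rho> t))) = \<mu> (Bcontfun (digit_E t))"
  using theI'[OF ex1_measure_with_permuted_values[OF assms, of "\<lambda>t. \<mu> (Bcontfun (digit_E t))"]]
  unfolding permute_measure_def by auto

lemma permute_measure_eqI:
  assumes "bij \<rho>" "\<nu> \<in> R_measures"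
    and "\<And>t. \<nu> (Bcontfun (digit_E (permute_digits p \<rho> t))) = \<mu> (Bcontfun (digit_E t))"
  shows "permute_measure \<rho> \<mu> = \<nu>"
  unfolding permute_measure_def
  by (rule the1_equality[OF ex1_measure_with_permuted_values[OF assms(1)]]) (simp add: assms(2,3))

lemma permute_measure_id: "\<mu> \<in> R_measures \<Longrightarrow> permute_measure id \<mu> = \<mu>"
  by (intro permute_measure_eqI) (simp_all add: permute_digits_id[OF p])

lemma permute_measure_comp:
  assumes "bij \<rho>" "bij \<tau>"
  shows "permute_measure (\<rho> \<circ> \<tau>) \<mu> = permute_measure \<rho> (permute_measure \<tau> \<mu>)"
  using assms
  by (intro permute_measure_eqI)
    (simp_all add: bij_comp permute_measure_in_R_measures permute_digits_comp[OF p] permute_measure_digit_E)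

lemma permute_measure_add:
  assumes "bij \<rho>"
  shows "permute_measure \<rho> (\<lambda>f. \<mu> f + \<nu> f) = (\<lambda>f. permute_measure \<rho> \<mu> f + permute_measure \<rho> \<nu> f)"
  using assms
  by (intro permute_measure_eqI)
    (simp_all add: add_in_R_measures permute_measure_in_R_measures permute_measure_digit_E)

lemma permute_measure_smult:
  assumes "bij \<rho>"
  shows "permute_measure \<rho> (\<lambda>f. a * \<mu> f) = (\<lambda>f. a * permute_measure \<rho> \<mu> f)"
  using assms
  by (intro permute_measure_eqI)
    (simp_all add: smult_in_R_measures permute_measure_in_R_measures permute_measure_digit_E)

lemma digit_E_at_0: "digit_E t 0 = (if t = 0 then 1 else 0)"
proof (cases "t = 0")
  case False
  have q: "CARD('a) \<ge> 2" by (rule card_finite_field_ge_2)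
  obtain i where i: "digit (CARD('a)) t i \<noteq> 0"
    using False digit_eqI[OF q, of t 0] by auto
  have "E i 0 = 0" for i using E_scale[of i 0 0] by simp
  then have "digit_E t 0 = (\<Prod>i | digit (CARD('a)) t i \<noteq> 0. 0 ^ digit (CARD('a)) t i)"
    by (simp add: digit_E_def digit_prod_def)
  also have "\<dots> = 0"
    using i finite_nonzero_digits[OF q] by (intro prod_zero) auto
  finally show ?thesis using False by simp
qed (simp add: digit_E_def)

text \<open>The Dirac measure at $0$ has the values $G_0(0) = 1$ and $G_t(0) = 0$ otherwise, and
  $0$ is the index without nonzero digits.\<close>

lemma permute_measure_dirac:
  assumes "bij \<rho>"
  shows "permute_measure \<rho> (\<lambda>f. apply_bcontfun f 0) = (\<lambda>f. apply_bcontfun f 0)"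
proof (rule permute_measure_eqI[OF assms dirac_in_R_measures])
  fix t
  have "permute_digits p \<rho> 0 = 0" by (simp add: permute_digits_def)
  then have "permute_digits p \<rho> t = 0 \<longleftrightarrow> t = 0"
    using bij_permute_digits[OF p assms] by (metis bij_pointE)
  then show "apply_bcontfun (Bcontfun (digit_E (permute_digits p \<rho> t))) 0 =
      apply_bcontfun (Bcontfun (digit_E t)) 0"
    by (simp add: apply_Bcontfun_fps continuous digit_E_at_0)
qed

text \<open>
  The coefficients in the formula for convolution are products of binomial coefficients of single
  digits, which do not notice a permutation of the digits.
\<close>

lemma permute_measure_convolution:
  assumes \<rho>: "bij \<rho>" and \<mu>: "\<mu> \<in> R_measures" and \<nu>: "\<nu> \<in> R_measures"
  shows "permute_measure \<rho> (convolution \<mu> \<nu>) = convolution (permute_measure \<rho> \<mu>) (permute_measure \<rho> \<nu>)"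
proof (rule permute_measure_eqI[OF \<rho>])
  show "convolution (permute_measure \<rho> \<mu>) (permute_measure \<rho> \<nu>) \<in> R_measures"
    by (intro convolution_in_R_measures permute_measure_in_R_measures \<rho>)
  fix t
  let ?\<sigma> = "permute_digits p \<rho>"
  have inj: "inj_on ?\<sigma> (dominated p t)"
    using bij_permute_digits[OF p \<rho>] by (meson bij_is_inj inj_on_subset subset_UNIV)
  have "convolution (permute_measure \<rho> \<mu>) (permute_measure \<rho> \<nu>) (Bcontfun (digit_E (?\<sigma> t))) =
      (\<Sum>s\<in>dominated p (?\<sigma> t). of_nat (digit_binom p (?\<sigma> t) s) *
        permute_measure \<rho> \<mu> (Bcontfun (digit_E s)) *
        permute_measure \<rho> \<nu> (Bcontfun (digit_E (?\<sigma> t - s))))"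
    by (intro convolution_digit_E permute_measure_in_R_measures \<rho>)
  also have "\<dots> = (\<Sum>s\<in>dominated p t. of_nat (digit_binom p (?\<sigma> t) (?\<sigma> s)) *
        permute_measure \<rho> \<mu> (Bcontfun (digit_E (?\<sigma> s))) *
        permute_measure \<rho> \<nu> (Bcontfun (digit_E (?\<sigma> t - ?\<sigma> s))))"
    unfolding dominated_permute_digits[OF p \<rho>] sum.reindex[OF inj] by simp
  also have "\<dots> = (\<Sum>s\<in>dominated p t. of_nat (digit_binom p t s) *
        \<mu> (Bcontfun (digit_E s)) * \<nu> (Bcontfun (digit_E (t - s))))"
    by (intro sum.cong refl)
      (simp add: digit_binom_permute_digits[OF p \<rho>] permute_measure_digit_E[OF \<rho>]
        flip: permute_digits_diff[OF p \<rho>])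
  also have "\<dots> = convolution \<mu> \<nu> (Bcontfun (digit_E t))"
    by (rule convolution_digit_E[OF \<mu> \<nu>, symmetric])
  finally show "convolution (permute_measure \<rho> \<mu>) (permute_measure \<rho> \<nu>) (Bcontfun (digit_E (?\<sigma> t))) =
      convolution \<mu> \<nu> (Bcontfun (digit_E t))" .
qed

end

section \<open>The group $S_{(p)}$\<close>

text \<open>
  A coherent sequence of residues amounts to its sequence of digits, and in terms of digits an
  element of $S_{(p)}$ is a mere reindexing.
\<close>

definition zp_of_digits :: "nat \<Rightarrow> (nat \<Rightarrow> nat) \<Rightarrow> (nat \<Rightarrow> nat)" where
  "zp_of_digits p d = (\<lambda>n. \<Sum>i<n. d i * p ^ i)"

lemma zp_digit_less:
  assumes "x \<in> zp p"
  shows "zp_digit p x i < p"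
proof -
  have "x (Suc i) < p * p ^ i" using assms by (simp add: zp_def flip: power_Suc)
  then show ?thesis unfolding zp_digit_def by (rule less_mult_imp_div_less)
qed

lemma zp_of_digits_zp_digit:
  assumes "x \<in> zp p"
  shows "zp_of_digits p (zp_digit p x) = x"
proof
  fix n show "zp_of_digits p (zp_digit p x) n = x n"
  proof (induction n)
    case 0
    have "x 0 < p ^ 0" using assms unfolding zp_def by blast
    then show ?case by (simp add: zp_of_digits_def)
  next
    case (Suc n)
    have "x (Suc n) mod p ^ n = x n" using assms by (simp add: zp_def)
    then have "x (Suc n) = x (Suc n) div p ^ n * p ^ n + x n" by (metis div_mult_mod_eq)
    with Suc show ?case by (simp add: zp_of_digits_def zp_digit_def)
  qed
qed

lemma zp_eqI:
  assumes "x \<in> zp p" "y \<in> zp p" "\<And>i. zp_digit p x i = zp_digit p y i"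
  shows "x = y"
  using zp_of_digits_zp_digit[OF assms(1)] zp_of_digits_zp_digit[OF assms(2)] assms(3)
  by (metis ext)

lemma zp_of_digits_in_zp:
  assumes "\<And>i. d i < p"
  shows "zp_of_digits p d \<in> zp p"
  using sum_digits_less[of d p, OF assms] by (simp add: zp_def zp_of_digits_def)

lemma zp_digit_zp_of_digits:
  assumes "\<And>i. d i < p"
  shows "zp_digit p (zp_of_digits p d) i = d i"
proof -
  have "p > 0" using assms[of 0] by simp
  then show ?thesis
    using sum_digits_less[of d p i, OF assms] by (simp add: zp_digit_def zp_of_digits_def)
qed

lemma rho_star_eq:
  assumes x: "x \<in> zp p" and \<rho>: "bij \<rho>"
  shows "rho_star p \<rho> x = zp_of_digits p (\<lambda>j. zp_digit p x (inv_into UNIV \<rho> j))"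
proof
  fix n
  have "(\<Sum>i | \<rho> i < n. zp_digit p x i * p ^ \<rho> i) =
      (\<Sum>j<n. zp_digit p x (inv_into UNIV \<rho> j) * p ^ j)"
    using \<rho>
    by (intro sum.reindex_bij_witness[of _ "inv_into UNIV \<rho>" \<rho>])
      (auto simp: bij_is_inj bij_is_surj surj_f_inv_f)
  moreover have "\<dots> < p ^ n" using x by (intro sum_digits_less zp_digit_less)
  ultimately show "rho_star p \<rho> x n = zp_of_digits p (\<lambda>j. zp_digit p x (inv_into UNIV \<rho> j)) n"
    by (simp add: rho_star_def zp_of_digits_def)
qed

lemma rho_star_in_zp: "x \<in> zp p \<Longrightarrow> bij \<rho> \<Longrightarrow> rho_star p \<rho> x \<in> zp p"
  by (simp add: rho_star_eq zp_of_digits_in_zp zp_digit_less)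

lemma zp_digit_rho_star:
  "x \<in> zp p \<Longrightarrow> bij \<rho> \<Longrightarrow> zp_digit p (rho_star p \<rho> x) (\<rho> i) = zp_digit p x i"
  by (simp add: rho_star_eq zp_digit_zp_of_digits zp_digit_less bij_is_inj)

lemma rho_star_eqI:
  assumes x: "x \<in> zp p" and y: "y \<in> zp p" and \<rho>: "bij \<rho>"
    and digits: "\<And>i. zp_digit p y (\<rho> i) = zp_digit p x i"
  shows "rho_star p \<rho> x = y"
proof (rule zp_eqI)
  fix j
  obtain i where j: "j = \<rho> i" using bij_is_surj[OF \<rho>] by (metis surjD)
  show "zp_digit p (rho_star p \<rho> x) j = zp_digit p y j"
    by (simp add: j digits zp_digit_rho_star x \<rho>)
qed (simp_all add: rho_star_in_zp x y \<rho>)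

lemma rho_star_comp:
  "x \<in> zp p \<Longrightarrow> bij \<rho> \<Longrightarrow> bij \<tau> \<Longrightarrow> rho_star p (\<rho> \<circ> \<tau>) x = rho_star p \<rho> (rho_star p \<tau> x)"
  by (intro rho_star_eqI) (simp_all add: bij_comp rho_star_in_zp zp_digit_rho_star)

lemma rho_star_id: "x \<in> zp p \<Longrightarrow> rho_star p id x = x"
  by (intro rho_star_eqI) simp_all

lemma rho_star_in_Bij:
  assumes \<rho>: "bij \<rho>"
  shows "restrict (rho_star p \<rho>) (zp p) \<in> Bij (zp p)"
proof -
  have "bij_betw (rho_star p \<rho>) (zp p) (zp p)"
  proof (rule bij_betw_byWitness[where f' = "rho_star p (inv_into UNIV \<rho>)"])
    show "\<forall>x\<in>zp p. rho_star p (inv_into UNIV \<rho>) (rho_star p \<rho> x) = x"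
      using bij_inv_comp[OF \<rho>] \<rho> by (simp add: rho_star_id flip: rho_star_comp)
    show "\<forall>x\<in>zp p. rho_star p \<rho> (rho_star p (inv_into UNIV \<rho>) x) = x"
      using bij_inv_comp[OF \<rho>] \<rho> by (simp add: rho_star_id flip: rho_star_comp)
  qed (use bij_inv_comp[OF \<rho>] \<rho> in \<open>auto intro: rho_star_in_zp\<close>)
  then show ?thesis by (simp add: Bij_def)
qed

lemma mult_rho_star:
  assumes "bij \<rho>" "bij \<tau>"
  shows "restrict (rho_star p \<rho>) (zp p) \<otimes>\<^bsub>BijGroup (zp p)\<^esub> restrict (rho_star p \<tau>) (zp p) =
    restrict (rho_star p (\<rho> \<circ> \<tau>)) (zp p)"
  using assms
  by (auto simp: BijGroup_def rho_star_in_Bij compose_def rho_star_comp rho_star_in_zp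
      intro!: restrict_ext)

lemma carrier_S_groupE:
  assumes "\<sigma> \<in> carrier (S_group p)"
  obtains \<rho> where "bij \<rho>" "\<sigma> = restrict (rho_star p \<rho>) (zp p)"
  using assms by (auto simp: S_group_def)

lemma group_S_group: "group (S_group p)"
proof -
  interpret group "BijGroup (zp p)" by (rule group_BijGroup)
  have "subgroup {restrict (rho_star p \<rho>) (zp p) | \<rho>. bij \<rho>} (BijGroup (zp p))" (is "subgroup ?H _")
  proof (rule subgroupI)
    show "?H \<subseteq> carrier (BijGroup (zp p))"
      using rho_star_in_Bij by (auto simp: BijGroup_def)
    show "?H \<noteq> {}" using bij_id by blast
  next
    fix \<sigma> assume "\<sigma> \<in> ?H"
    then obtain \<rho> where \<rho>: "bij \<rho>" "\<sigma> = restrict (rho_star p \<rho>) (zp p)" by blast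
    define \<tau> where "\<tau> = restrict (rho_star p (inv_into UNIV \<rho>)) (zp p)"
    have "\<tau> \<otimes>\<^bsub>BijGroup (zp p)\<^esub> \<sigma> = restrict (rho_star p id) (zp p)"
      using bij_inv_comp[OF \<rho>(1)] by (simp add: \<rho> \<tau>_def mult_rho_star)
    also have "\<dots> = \<one>\<^bsub>BijGroup (zp p)\<^esub>"
      by (auto simp: BijGroup_def rho_star_id intro!: restrict_ext)
    finally have "inv\<^bsub>BijGroup (zp p)\<^esub> \<sigma> = \<tau>"
      using bij_inv_comp(1)[OF \<rho>(1)] \<rho>
      by (intro inv_equality) (auto simp: \<tau>_def BijGroup_def rho_star_in_Bij)
    then show "inv\<^bsub>BijGroup (zp p)\<^esub> \<sigma> \<in> ?H"
      using bij_inv_comp(1)[OF \<rho>(1)] unfolding \<tau>_def by blast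
  next
    fix \<sigma> \<sigma>' assume "\<sigma> \<in> ?H" "\<sigma>' \<in> ?H"
    then obtain \<rho> \<tau> where "bij \<rho>" "\<sigma> = restrict (rho_star p \<rho>) (zp p)"
      and "bij \<tau>" "\<sigma>' = restrict (rho_star p \<tau>) (zp p)" by blast
    moreover from this have "bij (\<rho> \<circ> \<tau>)" by (intro bij_comp)
    ultimately show "\<sigma> \<otimes>\<^bsub>BijGroup (zp p)\<^esub> \<sigma>' \<in> ?H"
      by (simp only: mult_rho_star) blast
  qed
  then show ?thesis
    unfolding S_group_def by (rule subgroup.subgroup_is_group) (rule group_BijGroup)
qed

lemma zp_of_nat_eq: "zp_of_nat p t = zp_of_digits p (digit p t)"
  by (simp add: zp_of_nat_def zp_of_digits_def sum_digits)

lemma on_nat_rho_star: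
  assumes p: "p \<ge> 2" and \<rho>: "bij \<rho>"
  shows "on_nat p (restrict (rho_star p \<rho>) (zp p)) t = permute_digits p \<rho> t"
proof -
  have in_zp: "zp_of_nat p s \<in> zp p" for s
    unfolding zp_of_nat_eq using digit_less[OF p] by (rule zp_of_digits_in_zp)
  have digits: "zp_digit p (zp_of_nat p s) i = digit p s i" for s i
    unfolding zp_of_nat_eq using digit_less[OF p] by (rule zp_digit_zp_of_digits)
  have "rho_star p \<rho> (zp_of_nat p t) = zp_of_nat p (permute_digits p \<rho> t)"
    by (rule rho_star_eqI) (simp_all add: in_zp \<rho> digits digit_permute_digits[OF p \<rho>])
  moreover have "s = s'" if "zp_of_nat p s = zp_of_nat p s'" for s s'
  proof (rule digit_eqI[OF p])
    show "digit p s i = digit p s' i" for i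
      using that by (simp flip: digits)
  qed
  ultimately show ?thesis
    unfolding on_nat_def by (auto simp: in_zp)
qed

section \<open>The action on measures\<close>

context
  fixes e :: "nat \<Rightarrow> ('a::{field,finite} fps \<Rightarrow>\<^sub>C 'a fps)" and p m :: nat
  assumes e: "digit_measures (\<lambda>i. apply_bcontfun (e i)) p m"
begin

interpretation digit_measures "\<lambda>i. apply_bcontfun (e i)" p m
  by (rule e)

lemma digit_expansion_eq: "digit_expansion e t = Bcontfun (digit_E t)"
  by (simp add: digit_expansion_def digit_E_def[abs_def] digit_prod_def digit_def Let_def)

lemma is_transform_iff:
  assumes "bij \<rho>"
  shows "is_transform e p (restrict (rho_star p \<rho>) (zp p)) \<mu> \<nu> \<longleftrightarrow> \<nu> \<in> R_measures \<and>
    (\<forall>t. \<nu> (Bcontfun (digit_E (permute_digits p \<rho> t))) = \<mu> (Bcontfun (digit_E t)))"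
  by (simp add: is_transform_def digit_expansion_eq on_nat_rho_star[OF p assms])

lemma ex1_is_transform:
  assumes "\<sigma> \<in> carrier (S_group p)"
  shows "\<exists>!\<nu>. is_transform e p \<sigma> \<mu> \<nu>"
  using assms
  by (elim carrier_S_groupE) (simp add: is_transform_iff ex1_measure_with_permuted_values)

lemma transform_eq:
  assumes "bij \<rho>"
  shows "transform e p (restrict (rho_star p \<rho>) (zp p)) = restrict (permute_measure \<rho>) R_measures"
  by (simp add: transform_def is_transform_iff[OF assms] permute_measure_def[abs_def])

lemma bij_betw_permute_measure:
  assumes \<rho>: "bij \<rho>"
  shows "bij_betw (permute_measure \<rho>) R_measures R_measures"
proof (rule bij_betw_byWitness[where f' = "permute_measure (inv_into UNIV \<rho>)"])
  show "\<forall>\<mu>\<in>R_measures. permute_measure (inv_into UNIV \<rho>) (permute_measure \<rho> \<mu>) = \<mu>"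
    using bij_inv_comp[OF \<rho>] \<rho> by (simp add: permute_measure_id flip: permute_measure_comp)
  show "\<forall>\<mu>\<in>R_measures. permute_measure \<rho> (permute_measure (inv_into UNIV \<rho>) \<mu>) = \<mu>"
    using bij_inv_comp[OF \<rho>] \<rho> by (simp add: permute_measure_id flip: permute_measure_comp)
qed (use bij_inv_comp[OF \<rho>] \<rho> in \<open>auto intro: permute_measure_in_R_measures\<close>)

lemma transform_automorphism:
  assumes "\<sigma> \<in> carrier (S_group p)"
  shows "transform e p \<sigma> \<in> algebra_automorphisms (ring_of_type_algebra :: 'a fps ring) measure_algebra"
proof -
  from assms obtain \<rho> where \<rho>: "bij \<rho>" and \<sigma>: "\<sigma> = restrict (rho_star p \<rho>) (zp p)"
    by (rule carrier_S_groupE)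
  have "restrict (permute_measure \<rho>) R_measures \<in> ring_iso measure_algebra measure_algebra"
    by (rule ring_iso_memI)
      (simp_all add: measure_algebra_def \<rho> convolution_in_R_measures add_in_R_measures
        dirac_in_R_measures permute_measure_in_R_measures permute_measure_convolution
        permute_measure_add permute_measure_dirac bij_betw_permute_measure)
  then show ?thesis
    by (simp add: algebra_automorphisms_def \<sigma> transform_eq[OF \<rho>])
      (simp add: measure_algebra_def \<rho> smult_in_R_measures permute_measure_smult)
qed

lemma group_action_transform:
  "group_action (S_group p) (carrier (measure_algebra :: ('a fps, 'a functional) module)) (transform e p)"
proof -
  have carrier: "carrier (measure_algebra :: ('a fps, 'a functional) module) = R_measures"
    by (simp add: measure_algebra_def)
  have Bij: "restrict (permute_measure \<rho>) R_measures \<in> Bij R_measures" if "bij \<rho>" for \<rho>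
    using bij_betw_permute_measure[OF that] by (simp add: Bij_def)
  have "transform e p \<in> hom (S_group p) (BijGroup R_measures)"
  proof (rule homI)
    fix \<sigma> assume "\<sigma> \<in> carrier (S_group p)"
    then show "transform e p \<sigma> \<in> carrier (BijGroup R_measures)"
      by (elim carrier_S_groupE) (simp add: transform_eq BijGroup_def Bij)
  next
    fix \<sigma> \<sigma>' assume \<sigma>: "\<sigma> \<in> carrier (S_group p)" and \<sigma>': "\<sigma>' \<in> carrier (S_group p)"
    obtain \<rho> where \<rho>: "bij \<rho>" "\<sigma> = restrict (rho_star p \<rho>) (zp p)"
      using \<sigma> by (rule carrier_S_groupE)
    obtain \<tau> where \<tau>: "bij \<tau>" "\<sigma>' = restrict (rho_star p \<tau>) (zp p)"
      using \<sigma>' by (rule carrier_S_groupE)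
    have "\<sigma> \<otimes>\<^bsub>S_group p\<^esub> \<sigma>' = restrict (rho_star p (\<rho> \<circ> \<tau>)) (zp p)"
      by (simp add: S_group_def \<rho> \<tau> mult_rho_star)
    then have "transform e p (\<sigma> \<otimes>\<^bsub>S_group p\<^esub> \<sigma>') = restrict (permute_measure (\<rho> \<circ> \<tau>)) R_measures"
      by (simp add: transform_eq bij_comp \<rho>(1) \<tau>(1))
    also have "\<dots> = compose R_measures (restrict (permute_measure \<rho>) R_measures)
        (restrict (permute_measure \<tau>) R_measures)"
      using \<rho>(1) \<tau>(1)
      by (auto simp: compose_def permute_measure_comp permute_measure_in_R_measures intro!: restrict_ext)
    finally show "transform e p (\<sigma> \<otimes>\<^bsub>S_group p\<^esub> \<sigma>') =
        transform e p \<sigma> \<otimes>\<^bsub>BijGroup R_measures\<^esub> transform e p \<sigma>'"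
      by (simp add: \<rho> \<tau> transform_eq BijGroup_def Bij)
  qed
  then show ?thesis
    unfolding carrier
    by (intro group_action.intro group_hom.intro group_hom_axioms.intro group_S_group group_BijGroup)
qed

end

theorem corollary2:
  fixes p q m :: nat
    and e :: "nat \<Rightarrow> ('a::{field,finite} fps \<Rightarrow>\<^sub>C 'a fps)"
  assumes "Factorial_Ring.prime p"
    and "m \<ge> 1" and "q = p ^ m" and "CARD('a) = q"
    and "orthonormal_basis linear_functions e"
  shows "algebra (ring_of_type_algebra :: 'a fps ring) measure_algebra \<and>
    (\<forall>\<sigma>\<in>carrier (S_group p). \<forall>\<mu>\<in>R_measures. \<exists>!\<nu>. is_transform e p \<sigma> \<mu> \<nu>) \<and>
    group_action (S_group p) (carrier measure_algebra) (transform e p) \<and>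
    (\<forall>\<sigma>\<in>carrier (S_group p).
       transform e p \<sigma> \<in> algebra_automorphisms (ring_of_type_algebra :: 'a fps ring) measure_algebra)"
proof -
  have e: "digit_measures (\<lambda>i. apply_bcontfun (e i)) p m"
    using linear_residue_basis_if_orthonormal[OF assms(5)] assms(1-4)
    by (intro digit_measures.intro digit_measures_axioms.intro) simp_all
  interpret digit_measures "\<lambda>i. apply_bcontfun (e i)" p m by (rule e)
  show ?thesis
    using algebra_measure_algebra ex1_is_transform[OF e] group_action_transform[OF e]
      transform_automorphism[OF e] by blast
qed

end
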